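(* Let $n\ge 1$ be an integer, let $F:\mathbb{R}\times\mathbb{R}^n\to\mathbb{R}^n$ and $\Phi:\mathbb{R}\times\mathbb{R}^n\to\mathbb{R}$ be polynomial, let $\mathcal{T}=[t_0,T]$ be a finite time interval, and let $X_0\subset\mathbb{R}^n$ and $\Omega\subset\mathcal{T}\times\mathbb{R}^n$ be compact basic semialgebraic sets, $$X_0=\{x\in\mathbb{R}^n: f_1(x)\ge0,\ldots,f_p(x)\ge0,\ g_1(x)=0,\ldots,g_q(x)=0\},$$ $$\Omega=\{(t,x)\in\mathbb{R}\times\mathbb{R}^n: h_1(t,x)\ge0,\ldots,h_r(t,x)\ge0,\ \ell_1(t,x)=0,\ldots,\ell_s(t,x)=0\},$$ with all $f_i,g_i,h_i,\ell_i$ polynomials, such that the graph $\{(t,x(t;t_0,x_0)):t\in\mathcal{T}\}$ of every trajectory of $\dot x=F(t,x)$ starting at time $t_0$ from a point $x_0\in X_0$ is contained in $\Omega$. Assume that the inequalities in the definition of $\Omega$ include $C_1-t^2-\|x\|_2^2\ge0$ for some constant $C_1$, and that the inequalities in the definition of $X_0$ include $C_2-\|x\|_2^2\ge0$ for some constant $C_2$ (which can always be made true by adding inequalities that do not change the specified sets). Let $\Phi_T^*$, $\mathcal{V}(\Omega)$ and $\lambda_d^*$ be as defined in the context. If differentiable auxiliary functions give arbitrarily sharp bounds on $\Phi_T^*$, i.e. if $$\Phi_T^*=\inf_{V\in\mathcal{V}(\Omega)}\ \sup_{x_0\in X_0}V(t_0,x_0),$$ then $\lambda_d^*\to\Phi_T^*$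 as $d\to\infty$.
   Context: **Trajectories and the maximum.** $x(t;s,y)$ denotes the trajectory of the ODE $\dot x=F(t,x)$ that passes through $y$ at time $s$. Define $$\Phi_T^*:=\sup_{x_0\in X_0,\ t\in[t_0,T]}\Phi[t,x(t;t_0,x_0)].$$ **Auxiliary functions.** $\mathcal{V}(\Omega)$ is the set of all $V\in C^1(\Omega)$ (restrictions to $\Omega$ of continuously differentiable functions, with derivatives taken for the extension) that satisfy both $$\partial_tV(t,x)+F(t,x)\cdot\nabla_xV(t,x)\le0\quad\text{and}\quad \Phi(t,x)-V(t,x)\le0\qquad\text{for all }(t,x)\in\Omega.$$ **Polynomial spaces.** $\mathbb{R}_d[t,x]$ and $\mathbb{R}_d[x]$ are the vector spaces of real polynomials of degree at most $d$ in $(t,x)$ and in $x$, respectively. $\Sigma_\mu[t,x]$ and $\Sigma_\mu[x]$ are the cones of sum-of-squares polynomials of degree at most $\mu$ in $(t,x)$ and in $x$: for example, $\sigma\in\Sigma_\mu[x]$ if and only if $\sigma=\sum_{i=1}^kq_i^2$ for finitely many $q_i\in\mathbb{R}_{\lfloor\mu/2\rfloor}[x]$. **Weighted sums of squares.** For each integer $\mu$ no smaller than the highest degree of the polynomials defining $X_0$, let $$\Lambda_\mu:=\Big\{\sigma_0+\sum_{i=1}^pf_i\sigma_i+\sum_{i=1}^qg_i\rho_i:\ \sigma_0\in\Sigma_\mu[x],\ \sigma_i\in\Sigma_{\mu-\deg(f_i)}[x],\ \rho_i\in\mathbb{R}_{\mu-\deg(g_i)}[x]\Big\}.$$ For each integer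 $\mu$ no smaller than the highest degree of the polynomials defining $\Omega$, let $$\Gamma_\mu:=\Big\{\sigma_0+\sum_{i=1}^rh_i\sigma_i+\sum_{i=1}^s\ell_i\rho_i:\ \sigma_0\in\Sigma_\mu[t,x],\ \sigma_i\in\Sigma_{\mu-\deg(h_i)}[t,x],\ \rho_i\in\mathbb{R}_{\mu-\deg(\ell_i)}[t,x]\Big\}.$$ **The optimization problem.** For each (sufficiently large) integer $d$, let $\lambda_d^*$ be the infimum of all $\lambda\in\mathbb{R}$ for which there exists $V\in\mathbb{R}_d[t,x]$ such that $$-\partial_tV-F\cdot\nabla_xV\in\Gamma_{d-1+\deg(F)},\qquad V-\Phi\in\Gamma_d,\qquad \lambda-V(t_0,\cdot)\in\Lambda_d,$$ where $\deg(F)$ is the largest degree of the components of $F$, and $\lambda_d^*=+\infty$ if no such $\lambda$ exists. *)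

theory Defs
  imports "HOL-Analysis.Analysis"
begin

text \<open>
  Real polynomials are represented by the functions they induce; over the reals this loses
  nothing. The predicates \<^const>\<open>real_polynomial_function\<close> and \<^const>\<open>polynomial_function\<close> are
  those of HOL-Analysis; \<open>poly_space d\<close> adds the filtration by total degree. At
  type \<open>real^'n\<close> it is $R_d[x]$, at type \<open>real \<times> (real^'n)\<close> it is $R_d[t,x]$: the elements of
  \<^const>\<open>Basis\<close> are the coordinate directions, so \<open>\<alpha>\<close> is a multi-index of exponents.
\<close>

definition poly_space :: "nat \<Rightarrow> ('a::euclidean_space \<Rightarrow> real) set" where
  "poly_space d = {p. \<exists>A c. finite A \<and> (\<forall>\<alpha>\<in>A. (\<Sum>b\<in>Basis. \<alpha> b) \<le> d) \<and>
     p = (\<lambda>z. \<Sum>\<alpha>\<in>A. c \<alpha> * (\<Prod>b\<in>Basis. (z \<bullet> b) ^ \<alpha> b))}"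

text \<open>The zero polynomial gets degree 0. The value is meaningful for polynomial functions only.\<close>

definition poly_degree :: "('a::euclidean_space \<Rightarrow> real) \<Rightarrow> nat" where
  "poly_degree p = (LEAST d. p \<in> poly_space d)"

definition vec_poly_degree :: "('a::euclidean_space \<Rightarrow> real ^ 'n) \<Rightarrow> nat" where
  "vec_poly_degree F = (MAX i. poly_degree (\<lambda>z. F z $ i))"

definition sos :: "nat \<Rightarrow> ('a::euclidean_space \<Rightarrow> real) set" where
  "sos \<mu> = {\<sigma>. \<exists>qs. set qs \<subseteq> poly_space (\<mu> div 2) \<and> \<sigma> = (\<lambda>z. \<Sum>q\<leftarrow>qs. (q z)\<^sup>2)}"

definition semialgebraic_set ::
    "('a \<Rightarrow> real) list \<Rightarrow> ('a \<Rightarrow> real) list \<Rightarrow> 'a set" where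
  "semialgebraic_set fs gs = {z. (\<forall>f\<in>set fs. f z \<ge> 0) \<and> (\<forall>g\<in>set gs. g z = 0)}"

text \<open>
  For \<open>fs\<close>, \<open>gs\<close> defining $X_0$ this is $\Lambda_\mu$; for those defining $\Omega$ it is
  $\Gamma_\mu$. It is intended for \<open>\<mu>\<close> not below the degrees of the members of \<open>fs\<close>
  and \<open>gs\<close>, where the subtractions on \<^typ>\<open>nat\<close> do not truncate.
\<close>

definition weighted_sos ::
    "('a::euclidean_space \<Rightarrow> real) list \<Rightarrow> ('a \<Rightarrow> real) list \<Rightarrow> nat \<Rightarrow> ('a \<Rightarrow> real) set" where
  "weighted_sos fs gs \<mu> = {p. \<exists>\<sigma>\<^sub>0 \<sigma> \<rho>. \<sigma>\<^sub>0 \<in> sos \<mu> \<and>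
     (\<forall>i<length fs. \<sigma> i \<in> sos (\<mu> - poly_degree (fs ! i))) \<and>
     (\<forall>i<length gs. \<rho> i \<in> poly_space (\<mu> - poly_degree (gs ! i))) \<and>
     p = (\<lambda>z. \<sigma>\<^sub>0 z + (\<Sum>i<length fs. (fs ! i) z * \<sigma> i z)
                    + (\<Sum>i<length gs. (gs ! i) z * \<rho> i z))}"

definition partial_t :: "(real \<times> (real ^ 'n) \<Rightarrow> real) \<Rightarrow> real \<times> (real ^ 'n) \<Rightarrow> real" where
  "partial_t V z = frechet_derivative V (at z) (1, 0)"

definition grad_x :: "(real \<times> (real ^ 'n) \<Rightarrow> real) \<Rightarrow> real \<times> (real ^ 'n) \<Rightarrow> real ^ 'n" where
  "grad_x V z = (\<chi> i. frechet_derivative V (at z) (0, axis i 1))"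

definition C1_function :: "('a::real_normed_vector \<Rightarrow> real) \<Rightarrow> bool" where
  "C1_function V \<longleftrightarrow> (\<exists>V'. (\<forall>z. (V has_derivative blinfun_apply (V' z)) (at z)) \<and>
     continuous_on UNIV V')"

text \<open>
  An element of $C^1(\Omega)$ is represented by a continuously differentiable extension to the
  whole space, whose derivatives are the ones meant in the two conditions on \<open>\<Omega>\<close>.
\<close>

definition auxiliary_functions ::
    "(real \<times> (real ^ 'n) \<Rightarrow> real ^ 'n) \<Rightarrow> (real \<times> (real ^ 'n) \<Rightarrow> real) \<Rightarrow> (real \<times> (real ^ 'n)) set
     \<Rightarrow> (real \<times> (real ^ 'n) \<Rightarrow> real) set" where
  "auxiliary_functions F \<Phi> \<Omega> = {V. C1_function V \<and>
     (\<forall>z\<in>\<Omega>. partial_t V z + F z \<bullet> grad_x V z \<le> 0 \<and> \<Phi> z - V z \<le> 0)}"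

definition is_trajectory ::
    "(real \<times> (real ^ 'n) \<Rightarrow> real ^ 'n) \<Rightarrow> real \<Rightarrow> real \<Rightarrow> real ^ 'n \<Rightarrow> (real \<Rightarrow> real ^ 'n) \<Rightarrow> bool" where
  "is_trajectory F t\<^sub>0 T x\<^sub>0 y \<longleftrightarrow> y t\<^sub>0 = x\<^sub>0 \<and>
     (\<forall>t\<in>{t\<^sub>0..T}. (y has_vector_derivative F (t, y t)) (at t within {t\<^sub>0..T}))"

text \<open>
  \<open>x x\<^sub>0 t\<close> stands for $x(t;t_0,x_0)$. Since \<open>F\<close> is polynomial, hence locally Lipschitz, the
  values of \<open>x x\<^sub>0\<close> on \<open>{t\<^sub>0..T}\<close> are determined by \<^const>\<open>is_trajectory\<close>.
\<close>

definition max_along_trajectories ::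
    "(real \<times> (real ^ 'n) \<Rightarrow> real) \<Rightarrow> real \<Rightarrow> real \<Rightarrow> (real ^ 'n) set \<Rightarrow> (real ^ 'n \<Rightarrow> real \<Rightarrow> real ^ 'n)
     \<Rightarrow> ereal" where
  "max_along_trajectories \<Phi> t\<^sub>0 T X\<^sub>0 x =
     (SUP (x\<^sub>0, t) \<in> X\<^sub>0 \<times> {t\<^sub>0..T}. ereal (\<Phi> (t, x x\<^sub>0 t)))"

text \<open>
  The infimum is taken in \<^typ>\<open>ereal\<close>, so it is \<open>\<infinity>\<close> if no \<open>L\<close> is feasible. Only its values for
  large \<open>d\<close> are of interest: \<open>d \<ge> 1\<close>, and each index of \<^const>\<open>weighted_sos\<close> at least
  the degrees of the polynomials in its two lists.
\<close>

definition sos_bound ::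
    "(real \<times> (real ^ 'n) \<Rightarrow> real ^ 'n) \<Rightarrow> (real \<times> (real ^ 'n) \<Rightarrow> real) \<Rightarrow> real
     \<Rightarrow> (real ^ 'n \<Rightarrow> real) list \<Rightarrow> (real ^ 'n \<Rightarrow> real) list
     \<Rightarrow> (real \<times> (real ^ 'n) \<Rightarrow> real) list \<Rightarrow> (real \<times> (real ^ 'n) \<Rightarrow> real) list \<Rightarrow> nat \<Rightarrow> ereal" where
  "sos_bound F \<Phi> t\<^sub>0 fs gs hs ls d = Inf {ereal L | L. \<exists>V \<in> poly_space d.
     (\<lambda>z. - partial_t V z - F z \<bullet> grad_x V z) \<in> weighted_sos hs ls (d - 1 + vec_poly_degree F) \<and>
     (\<lambda>z. V z - \<Phi> z) \<in> weighted_sos hs ls d \<and>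
     (\<lambda>x. L - V (t\<^sub>0, x)) \<in> weighted_sos fs gs d}"

end

theory Submission
  imports Defs
begin

text \<open>
  Both inequalities rest on the assumption that differentiable auxiliary functions are sharp.

  A polynomial that is feasible for some bound \<open>L\<close> satisfies the three inequalities behind the
  certificates pointwise, because weighted sums of squares are nonnegative on the semialgebraic set.
  It is therefore an auxiliary function with \<open>V (t\<^sub>0, x\<^sub>0) \<le> L\<close> on \<open>X\<^sub>0\<close>, and the infimum over all
  auxiliary functions is at most \<open>L\<close>. So no \<^const>\<open>sos_bound\<close> lies below the maximum.

  Conversely, a near-optimal continuously differentiable \<open>V\<close> is tilted by a small multiple of
  \<open>1 + T - t\<close>, which makes its inequalities strict, and is then replaced by a polynomial
  that is close to it together with its first derivatives on the compact set
  \<open>\<Omega> \<union> {t\<^sub>0} \<times> X\<^sub>0\<close> (\<open>strict_polynomial_certificate\<close>). The three expressions of the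
  optimization problem are now polynomials that are positive on \<open>\<Omega>\<close> or on \<open>X\<^sub>0\<close>. Since a ball
  constraint is among the inequalities, Putinar's theorem (\<open>putinar_positivstellensatz\<close>) represents
  them as weighted sums of squares of some degree, hence of every larger one, and the polynomial is
  feasible for all large \<open>d\<close>.

  Putinar's theorem is derived from Jacobi's argument on quadratic modules. A proper
  Archimedean quadratic module is contained in a maximal one, which orders the polynomials well
  enough to assign to each of them a real value; this assignment is evaluation at a point
  (\<open>archimedean_module_has_point\<close>). A polynomial that is positive wherever the module is
  nonnegative then satisfies \<open>s * a - 1 \<in> Q\<close> for a sum of squares \<open>s\<close>, and an iteration removes the
  factor \<open>s\<close> (\<open>archimedean_positivstellensatz\<close>).

  The approximation of a function together with its first derivatives is done by multivariate
  Bernstein polynomials (\<open>C1_approximation_compact\<close>): their partial derivatives are again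
  Bernstein averages, of difference quotients.
\<close>

section \<open>Quadratic modules of polynomials\<close>

definition quadratic_module :: "('a::euclidean_space \<Rightarrow> real) set \<Rightarrow> bool" where
  "quadratic_module Q \<longleftrightarrow> (\<forall>p\<in>Q. real_polynomial_function p) \<and> (\<lambda>_. 1) \<in> Q \<and>
     (\<forall>p\<in>Q. \<forall>q\<in>Q. (\<lambda>z. p z + q z) \<in> Q) \<and>
     (\<forall>p\<in>Q. \<forall>q. real_polynomial_function q \<longrightarrow> (\<lambda>z. (q z)\<^sup>2 * p z) \<in> Q)"

definition archimedean :: "('a::euclidean_space \<Rightarrow> real) set \<Rightarrow> bool" where
  "archimedean Q \<longleftrightarrow> (\<forall>p. real_polynomial_function p \<longrightarrow> (\<exists>r. (\<lambda>z. r - p z) \<in> Q))"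

definition sum_of_squares :: "('a::euclidean_space \<Rightarrow> real) \<Rightarrow> bool" where
  "sum_of_squares s \<longleftrightarrow>
     (\<exists>qs. (\<forall>q\<in>set qs. real_polynomial_function q) \<and> s = (\<lambda>z. \<Sum>q\<leftarrow>qs. (q z)\<^sup>2))"

lemma member_pointwise: "p \<in> Q \<Longrightarrow> (\<And>z. q z = p z) \<Longrightarrow> q \<in> Q"
  by (metis ext)

lemma bounded_linear_eq_sum_Basis:
  fixes f :: "'a::euclidean_space \<Rightarrow> real"
  assumes "bounded_linear f"
  shows "f z = (\<Sum>b\<in>Basis. f b * (z \<bullet> b))"
proof -
  interpret bounded_linear f by fact
  have "f z = f (\<Sum>b\<in>Basis. (z \<bullet> b) *\<^sub>R b)" by (simp only: euclidean_representation)
  then show ?thesis by (simp only: sum scaleR real_scaleR_def mult.commute)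
qed

lemma sum_of_squares_zero: "sum_of_squares (\<lambda>_. 0)"
  unfolding sum_of_squares_def by (rule exI[of _ "[]"]) simp

lemma sum_of_squares_square:
  "real_polynomial_function q \<Longrightarrow> sum_of_squares (\<lambda>z. (q z)\<^sup>2)"
  unfolding sum_of_squares_def by (rule exI[of _ "[q]"]) simp

lemma sum_of_squares_add:
  assumes "sum_of_squares s" "sum_of_squares t"
  shows "sum_of_squares (\<lambda>z. s z + t z)"
proof -
  obtain ps qs where "\<forall>q\<in>set ps. real_polynomial_function q" "s = (\<lambda>z. \<Sum>q\<leftarrow>ps. (q z)\<^sup>2)"
    "\<forall>q\<in>set qs. real_polynomial_function q" "t = (\<lambda>z. \<Sum>q\<leftarrow>qs. (q z)\<^sup>2)"
    using assms unfolding sum_of_squares_def by auto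
  then show ?thesis
    unfolding sum_of_squares_def by (intro exI[of _ "ps @ qs"]) auto
qed

lemma sum_of_squares_times_square:
  assumes "sum_of_squares s" "real_polynomial_function p"
  shows "sum_of_squares (\<lambda>z. (p z)\<^sup>2 * s z)"
proof -
  obtain qs where "\<forall>q\<in>set qs. real_polynomial_function q" "s = (\<lambda>z. \<Sum>q\<leftarrow>qs. (q z)\<^sup>2)"
    using assms unfolding sum_of_squares_def by auto
  then show ?thesis
    unfolding sum_of_squares_def using assms(2)
    by (intro exI[of _ "map (\<lambda>q z. p z * q z) qs"])
       (auto simp: sum_list_const_mult power_mult_distrib o_def)
qed

lemma sum_of_squares_polynomial:
  assumes "sum_of_squares s"
  shows "real_polynomial_function s"
proof -
  have "real_polynomial_function (\<lambda>z. \<Sum>q\<leftarrow>qs. (q z)\<^sup>2)"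
    if "\<forall>q\<in>set qs. real_polynomial_function q" for qs :: "('a \<Rightarrow> real) list"
    using that by (induction qs) auto
  then show ?thesis
    using assms unfolding sum_of_squares_def by blast
qed

definition adjoin :: "('a::euclidean_space \<Rightarrow> real) set \<Rightarrow> ('a \<Rightarrow> real) \<Rightarrow> ('a \<Rightarrow> real) set" where
  "adjoin Q a = {p. \<exists>q\<in>Q. \<exists>s. sum_of_squares s \<and> p = (\<lambda>z. q z + s z * a z)}"

context
  fixes Q :: "('a::euclidean_space \<Rightarrow> real) set"
  assumes Q: "quadratic_module Q"
begin

lemma module_polynomial: "p \<in> Q \<Longrightarrow> real_polynomial_function p"
  and module_one: "(\<lambda>_. 1) \<in> Q"
  and module_add: "p \<in> Q \<Longrightarrow> q \<in> Q \<Longrightarrow> (\<lambda>z. p z + q z) \<in> Q"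
  and module_times_square: "p \<in> Q \<Longrightarrow> real_polynomial_function q \<Longrightarrow> (\<lambda>z. (q z)\<^sup>2 * p z) \<in> Q"
  using Q unfolding quadratic_module_def by auto

lemma module_scale: "p \<in> Q \<Longrightarrow> 0 \<le> c \<Longrightarrow> (\<lambda>z. c * p z) \<in> Q"
  using module_times_square[of p "\<lambda>_. sqrt c"] by auto

lemma module_const: "0 \<le> c \<Longrightarrow> (\<lambda>_. c) \<in> Q"
  using module_scale[OF module_one, of c] by simp

lemma module_square: "real_polynomial_function q \<Longrightarrow> (\<lambda>z. (q z)\<^sup>2) \<in> Q"
  using module_times_square[OF module_one] by simp

lemma module_times_sum_of_squares:
  assumes "p \<in> Q" "sum_of_squares s"
  shows "(\<lambda>z. s z * p z) \<in> Q"
proof -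
  have "(\<lambda>z. (\<Sum>q\<leftarrow>qs. (q z)\<^sup>2) * p z) \<in> Q"
    if "\<forall>q\<in>set qs. real_polynomial_function q" for qs :: "('a \<Rightarrow> real) list"
    using that
  proof (induction qs)
    case Nil
    then show ?case using module_const[of 0] by simp
  next
    case (Cons q qs)
    then show ?case
      using module_add[OF module_times_square[OF assms(1), of q]] by (simp add: distrib_right)
  qed
  then show ?thesis
    using assms(2) unfolding sum_of_squares_def by blast
qed

lemma module_sum_of_squares: "sum_of_squares s \<Longrightarrow> s \<in> Q"
  using module_times_sum_of_squares[OF module_one] by simp

text \<open>
  The identity $2r(r^2 - a^2) = (r+a)^2(r-a) + (r-a)^2(r+a)$ turns the linear bounds $r \pm a$
  into a quadratic one. Products of two members of a quadratic module need not be members, so this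
  is the way to multiply bounds.
\<close>

lemma module_minus_square:
  assumes "real_polynomial_function a" "0 < r" "(\<lambda>z. r - a z) \<in> Q" "(\<lambda>z. r + a z) \<in> Q"
  shows "(\<lambda>z. r\<^sup>2 - (a z)\<^sup>2) \<in> Q"
proof -
  have "(\<lambda>z. (r + a z)\<^sup>2 * (r - a z)) \<in> Q" "(\<lambda>z. (r - a z)\<^sup>2 * (r + a z)) \<in> Q"
    using assms by (auto intro!: module_times_square)
  note module_scale[OF module_add[OF this], of "1 / (2 * r)"]
  then show ?thesis
  proof (rule member_pointwise)
    fix z
    have "(r + a z)\<^sup>2 * (r - a z) + (r - a z)\<^sup>2 * (r + a z) = 2 * r * (r\<^sup>2 - (a z)\<^sup>2)"
      by algebra
    then show "r\<^sup>2 - (a z)\<^sup>2 = 1 / (2 * r) * ((r + a z)\<^sup>2 * (r - a z) + (r - a z)\<^sup>2 * (r + a z))"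
      using assms(2) by simp
  qed (use assms(2) in simp)
qed

lemma module_const_minus_mono:
  assumes "(\<lambda>z. r - p z) \<in> Q" "r \<le> r'"
  shows "(\<lambda>z. r' - p z) \<in> Q"
  by (rule member_pointwise[OF module_add[OF assms(1) module_const[of "r' - r"]]])
     (use assms(2) in auto)

text \<open>
  The polynomials bounded above and below modulo \<open>Q\<close> form a ring, because squares of bounded
  polynomials are bounded and $4pq = (p+q)^2 - (p-q)^2$. A ball constraint bounds every square of a
  coordinate, hence every coordinate, and the coordinates generate all polynomials.
\<close>

lemma archimedean_if_ball:
  assumes "(\<lambda>z. R - (norm z)\<^sup>2) \<in> Q"
  shows "archimedean Q"
proof -
  define bdd where "bdd p \<longleftrightarrow> (\<exists>r>0. (\<lambda>z. r - p z) \<in> Q \<and> (\<lambda>z. r + p z) \<in> Q)" for p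
  have bddI: "bdd p" if "(\<lambda>z. r - p z) \<in> Q" "(\<lambda>z. r + p z) \<in> Q" for p r
  proof -
    have "(\<lambda>z. max r 1 - p z) \<in> Q" "(\<lambda>z. max r 1 + p z) \<in> Q"
      using module_const_minus_mono[OF that(1), of "max r 1"]
        module_const_minus_mono[of r "\<lambda>z. - p z" "max r 1"] that(2) by auto
    then show ?thesis
      unfolding bdd_def by (intro exI[of _ "max r 1"]) auto
  qed
  have bdd_const: "bdd (\<lambda>_. c)" for c
    by (rule bddI[of "\<bar>c\<bar>"]) (auto intro!: module_const)
  have bdd_add: "bdd (\<lambda>z. p z + q z)" if pq: "bdd p" "bdd q" for p q
  proof -
    obtain r s where *: "(\<lambda>z. r - p z) \<in> Q" "(\<lambda>z. r + p z) \<in> Q" "(\<lambda>z. s - q z) \<in> Q" "(\<lambda>z. s + q z) \<in> Q"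
      using pq unfolding bdd_def by auto
    show ?thesis
      by (rule bddI[of "r + s"]; rule member_pointwise[OF module_add[OF *(1,3)]]
          member_pointwise[OF module_add[OF *(2,4)]]) auto
  qed
  have bdd_square: "\<exists>r. (\<lambda>z. r - (p z)\<^sup>2) \<in> Q" if "bdd p" "real_polynomial_function p" for p
    using that module_minus_square unfolding bdd_def by blast
  have bdd_mult: "bdd (\<lambda>z. p z * q z)"
    if pq: "bdd p" "bdd q" "real_polynomial_function p" "real_polynomial_function q" for p q
  proof -
    obtain r s where rs: "(\<lambda>z. r - (p z)\<^sup>2) \<in> Q" "(\<lambda>z. s - (q z)\<^sup>2) \<in> Q"
      using bdd_square pq by meson
    have sq: "(\<lambda>z. (p z + q z)\<^sup>2) \<in> Q" "(\<lambda>z. (p z - q z)\<^sup>2) \<in> Q"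
      using pq by (auto intro!: module_square)
    note * = module_scale[OF module_add[OF module_add[OF rs] sq(1)], of "1/2"]
      module_scale[OF module_add[OF module_add[OF rs] sq(2)], of "1/2"]
    show ?thesis
      by (rule bddI[of "(r + s) / 2"]; rule member_pointwise[OF *(2)] member_pointwise[OF *(1)])
         (auto simp: power2_eq_square algebra_simps add_divide_distrib)
  qed
  have bdd_coord: "bdd (\<lambda>z. z \<bullet> b)" if b: "b \<in> Basis" for b
  proof -
    have poly: "real_polynomial_function (\<lambda>z. z \<bullet> c)" for c :: 'a
      by (intro real_polynomial_function.intros(1) bounded_linear_inner_left)
    have "(\<lambda>z. \<Sum>c\<in>B. (z \<bullet> c)\<^sup>2) \<in> Q" if "finite B" for B :: "'a set"
      using that
    proof induction
      case empty
      then show ?case using module_const[of 0] by simp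
    next
      case (insert c B)
      then show ?case using module_add[OF module_square[OF poly[of c]]] by simp
    qed
    from module_add[OF assms this[of "Basis - {b}"]]
    have "(\<lambda>z. R - (norm z)\<^sup>2 + (\<Sum>c\<in>Basis - {b}. (z \<bullet> c)\<^sup>2)) \<in> Q" by simp
    moreover have "(norm z)\<^sup>2 = (z \<bullet> b)\<^sup>2 + (\<Sum>c\<in>Basis - {b}. (z \<bullet> c)\<^sup>2)" for z :: 'a
      unfolding power2_norm_eq_inner euclidean_inner[of z z]
      using sum.remove[OF finite_Basis b, of "\<lambda>c. (z \<bullet> c)\<^sup>2"] by (simp add: power2_eq_square)
    ultimately have R: "(\<lambda>z. R - (z \<bullet> b)\<^sup>2) \<in> Q" by simp
    \<comment> \<open>A coordinate $x$ is bounded through $R - x^2 + (x \mp 1/2)^2 = R + 1/4 \mp x$.\<close>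
    have sq: "(\<lambda>z. (z \<bullet> b - 1/2)\<^sup>2) \<in> Q" "(\<lambda>z. (z \<bullet> b + 1/2)\<^sup>2) \<in> Q"
      using poly[of b] by (auto intro!: module_square)
    show ?thesis
      by (rule bddI[of "R + 1/4"]; rule member_pointwise[OF module_add[OF R sq(1)]]
          member_pointwise[OF module_add[OF R sq(2)]])
         (auto simp: power2_eq_square algebra_simps)
  qed
  have bdd_sum: "bdd (\<lambda>z. \<Sum>i\<in>I. f i z)" if "finite I" "\<And>i. i \<in> I \<Longrightarrow> bdd (f i)" for I :: "'a set" and f
    using that by (induction) (auto intro: bdd_const bdd_add)
  have "bdd p" if "real_polynomial_function p" for p
    using that
  proof (induction rule: real_polynomial_function.induct)
    case (linear f)
    have "f = (\<lambda>z. \<Sum>b\<in>Basis. f b * (z \<bullet> b))"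
      by (rule ext bounded_linear_eq_sum_Basis linear)+
    moreover have "bdd (\<lambda>z. f b * (z \<bullet> b))" if "b \<in> Basis" for b
      by (rule bdd_mult[OF bdd_const bdd_coord[OF that]])
         (auto intro: real_polynomial_function.intros(1) bounded_linear_inner_left)
    then have "bdd (\<lambda>z. \<Sum>b\<in>Basis. f b * (z \<bullet> b))"
      by (rule bdd_sum[OF finite_Basis])
    ultimately show ?case by simp
  qed (auto intro: bdd_const bdd_add bdd_mult)
  then show ?thesis
    unfolding archimedean_def bdd_def by blast
qed

lemma adjoinI:
  "q \<in> Q \<Longrightarrow> sum_of_squares s \<Longrightarrow> (\<And>z. p z = q z + s z * a z) \<Longrightarrow> p \<in> adjoin Q a"
  unfolding adjoin_def by blast

lemma adjoin_superset: "Q \<subseteq> adjoin Q a"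
  using adjoinI[OF _ sum_of_squares_zero] by auto

lemma adjoin_member: "a \<in> adjoin Q a"
  using adjoinI[OF module_const[of 0] sum_of_squares_square[of "\<lambda>_. 1"]] by auto

lemma adjoin_quadratic_module:
  assumes "real_polynomial_function a"
  shows "quadratic_module (adjoin Q a)"
  unfolding quadratic_module_def
proof (intro conjI ballI allI impI)
  show "real_polynomial_function p" if "p \<in> adjoin Q a" for p
    using that assms unfolding adjoin_def
    by (auto intro!: real_polynomial_function.intros(3,4) intro: module_polynomial sum_of_squares_polynomial)
  show "(\<lambda>_. 1) \<in> adjoin Q a"
    using adjoin_superset module_one by blast
next
  fix p p' assume "p \<in> adjoin Q a" "p' \<in> adjoin Q a"
  then obtain q s q' s' where "q \<in> Q" "sum_of_squares s" "p = (\<lambda>z. q z + s z * a z)"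
      "q' \<in> Q" "sum_of_squares s'" "p' = (\<lambda>z. q' z + s' z * a z)"
    unfolding adjoin_def by blast
  then show "(\<lambda>z. p z + p' z) \<in> adjoin Q a"
    by (intro adjoinI[OF module_add[of q q'] sum_of_squares_add[of s s']])
       (auto simp: algebra_simps)
next
  fix p f :: "'a \<Rightarrow> real" assume "p \<in> adjoin Q a" and f: "real_polynomial_function f"
  then obtain q s where "q \<in> Q" "sum_of_squares s" "p = (\<lambda>z. q z + s z * a z)"
    unfolding adjoin_def by blast
  then show "(\<lambda>z. (f z)\<^sup>2 * p z) \<in> adjoin Q a"
    using f by (intro adjoinI[OF module_times_square[of q f] sum_of_squares_times_square[of s f]])
       (auto simp: algebra_simps)
qed

text \<open>
  The symmetric part of a quadratic module is an ideal, since every polynomial is a difference of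
  two squares: $a = ((a+1)/2)^2 - ((a-1)/2)^2$.
\<close>

lemma module_times_if_symmetric:
  assumes "i \<in> Q" "(\<lambda>z. - i z) \<in> Q" "real_polynomial_function a"
  shows "(\<lambda>z. a z * i z) \<in> Q"
proof -
  have "(\<lambda>z. ((a z + 1) / 2)\<^sup>2 * i z) \<in> Q" "(\<lambda>z. ((a z - 1) / 2)\<^sup>2 * (- i z)) \<in> Q"
    by (intro module_times_square[OF assms(1)] module_times_square[OF assms(2)]
        real_polynomial_function_divide real_polynomial_function.intros(2,3)
        real_polynomial_function_diff assms(3))+
  from module_add[OF this] show ?thesis
    by (rule member_pointwise) (simp add: power2_eq_square field_simps)
qed

end

section \<open>Maximal modules and the Archimedean Positivstellensatz\<close>

lemma ex_maximal_module:
  assumes "quadratic_module Q" "(\<lambda>_. -1) \<notin> Q"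
  obtains M where "quadratic_module M" "(\<lambda>_. -1) \<notin> M" "Q \<subseteq> M"
    "\<And>N. quadratic_module N \<Longrightarrow> (\<lambda>_. -1) \<notin> N \<Longrightarrow> M \<subseteq> N \<Longrightarrow> N = M"
proof -
  define \<A> where "\<A> = {N. quadratic_module N \<and> (\<lambda>_. -1) \<notin> N \<and> Q \<subseteq> N}"
  have "\<exists>M\<in>\<A>. \<forall>N\<in>\<A>. M \<subseteq> N \<longrightarrow> N = M"
  proof (rule subset_Zorn_nonempty)
    show "\<A> \<noteq> {}" using assms unfolding \<A>_def by blast
  next
    fix C assume "C \<noteq> {}" and C: "subset.chain \<A> C"
    have sub: "C \<subseteq> \<A>" and comp: "\<And>A B. A \<in> C \<Longrightarrow> B \<in> C \<Longrightarrow> A \<subseteq> B \<or> B \<subseteq> A"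
      using C unfolding subset_chain_def by auto
    have "(\<lambda>z. p z + q z) \<in> \<Union>C" if pq: "p \<in> \<Union>C" "q \<in> \<Union>C" for p q
    proof -
      obtain A B where AB: "A \<in> C" "p \<in> A" "B \<in> C" "q \<in> B" using pq by blast
      then obtain D where "D \<in> C" "p \<in> D" "q \<in> D" using comp[of A B] by blast
      moreover have "quadratic_module D" using sub \<open>D \<in> C\<close> unfolding \<A>_def by blast
      ultimately show ?thesis using module_add[of D p q] by blast
    qed
    note closed_add = this
    have C_qm: "quadratic_module N" and C_sup: "Q \<subseteq> N" "(\<lambda>_. -1) \<notin> N" if "N \<in> C" for N
      using sub that unfolding \<A>_def by auto
    have "quadratic_module (\<Union>C)"
      unfolding quadratic_module_def
    proof (intro conjI ballI allI impI closed_add)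
      show "(\<lambda>_. 1) \<in> \<Union>C" using \<open>C \<noteq> {}\<close> C_qm module_one by blast
    qed (use C_qm module_polynomial module_times_square in blast)+
    then show "\<Union>C \<in> \<A>"
      using \<open>C \<noteq> {}\<close> C_sup unfolding \<A>_def by blast
  qed
  then obtain M where M: "M \<in> \<A>" "\<forall>N\<in>\<A>. M \<subseteq> N \<longrightarrow> N = M" by blast
  show thesis
    by (rule that[of M]) (use M in \<open>auto simp: \<A>_def\<close>)
qed

text \<open>
  If neither \<open>a\<close> nor \<open>-a\<close> were a member, then by maximality $-1 = q + sa = q' - s'a$ with
  sums of squares $s, s'$. Eliminating $a$ puts $-s'$ into the module, so $s'$ lies in its symmetric
  part, and so does $s'a$; but $s'a = 1 + q'$, which forces $-1$ into the module.
\<close>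

lemma maximal_module_total:
  assumes M: "quadratic_module M" "(\<lambda>_. -1) \<notin> M"
    and max: "\<And>N. quadratic_module N \<Longrightarrow> (\<lambda>_. -1) \<notin> N \<Longrightarrow> M \<subseteq> N \<Longrightarrow> N = M"
    and a: "real_polynomial_function a"
  shows "a \<in> M \<or> (\<lambda>z. - a z) \<in> M"
proof (rule ccontr)
  assume not: "\<not> ?thesis"
  have minus: "(\<lambda>_. -1) \<in> adjoin M b" if "b \<notin> M" "real_polynomial_function b" for b
    using max[of "adjoin M b"] that adjoin_quadratic_module[OF M(1)] adjoin_superset[OF M(1)]
      adjoin_member[OF M(1)] by metis
  obtain q s where q: "q \<in> M" "sum_of_squares s" and qs: "\<And>z. -1 = q z + s z * a z"
    using minus[of a] not a unfolding adjoin_def by (auto dest: fun_cong)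
  obtain q' s' where q': "q' \<in> M" "sum_of_squares s'" and qs': "\<And>z. -1 = q' z + s' z * (- a z)"
    using minus[of "\<lambda>z. - a z"] not a unfolding adjoin_def by (auto dest: fun_cong)
  have eq: "s z + s z * q' z + s' z + s' z * q z = 0" for z
  proof -
    have "s z * a z = - 1 - q z" "s' z * a z = 1 + q' z"
      using qs[of z] qs'[of z] by auto
    then have "s' z * (s z * a z) = s' z * (- 1 - q z)" "s z * (s' z * a z) = s z * (1 + q' z)"
      by simp_all
    then show ?thesis by (simp add: algebra_simps)
  qed
  note in_M = module_add[OF M(1)] module_times_sum_of_squares[OF M(1)] module_sum_of_squares[OF M(1)]
  have "(\<lambda>z. (s z + s z * q' z) + s' z * q z) \<in> M"
    by (intro in_M(1) in_M(2)[OF q'(1) q(2)] in_M(2)[OF q(1) q'(2)] in_M(3) q q')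
  then have "(\<lambda>z. - s' z) \<in> M"
    proof (rule member_pointwise)
    show "- s' z = s z + s z * q' z + s' z * q z" for z
      using eq[of z] by linarith
  qed
  then have "(\<lambda>z. (- a z) * s' z) \<in> M"
    by (rule module_times_if_symmetric[OF M(1) in_M(3)[OF q'(2)] _ real_polynomial_function_minus[OF a]])
  from module_add[OF M(1) this q'(1)] have "(\<lambda>_. -1) \<in> M"
    by (rule member_pointwise) (use qs' in \<open>simp add: algebra_simps\<close>)
  then show False using M(2) by blast
qed

text \<open>
  In a maximal module every polynomial is comparable with every constant, and the Archimedean
  property confines it between two constants. So it has a value, the cut that it makes in the reals.
  Taking values respects sums and products, and is therefore evaluation at the point whose coordinates are
  the values of the coordinate functions. Members of the module have nonnegative values.
\<close>

lemma archimedean_module_has_point: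
  fixes Q :: "('a::euclidean_space \<Rightarrow> real) set"
  assumes "quadratic_module Q" "archimedean Q" "(\<lambda>_. -1) \<notin> Q"
  obtains z where "\<And>p. p \<in> Q \<Longrightarrow> 0 \<le> p z"
proof -
  obtain M where M: "quadratic_module M" "(\<lambda>_. -1) \<notin> M" "Q \<subseteq> M"
    and max: "\<And>N. quadratic_module N \<Longrightarrow> (\<lambda>_. -1) \<notin> N \<Longrightarrow> M \<subseteq> N \<Longrightarrow> N = M"
    using ex_maximal_module[OF assms(1,3)] by blast
  have total: "p \<in> M \<or> (\<lambda>z. - p z) \<in> M" if "real_polynomial_function p" for p
    by (rule maximal_module_total[OF M(1,2) _ that]) (use max in blast)
  have const: "0 \<le> c" if "(\<lambda>_. c) \<in> M" for c
    using module_scale[OF M(1) that, of "- 1 / c"] M(2) by (cases "c < 0") auto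
  \<comment> \<open>\<open>val p c\<close> says that modulo \<open>M\<close> the polynomial \<open>p\<close> differs infinitesimally from \<open>c\<close>.\<close>
  define val where "val p c \<longleftrightarrow> real_polynomial_function p \<and>
      (\<forall>\<epsilon>>0. (\<lambda>z. c + \<epsilon> - p z) \<in> M \<and> (\<lambda>z. p z - c + \<epsilon>) \<in> M)" for p :: "'a \<Rightarrow> real" and c
  have val_ex: "\<exists>c. val p c" if p: "real_polynomial_function p" for p
  proof -
    obtain r where r: "(\<lambda>z. r - p z) \<in> M"
      using assms(2) p M(3) unfolding archimedean_def by blast
    obtain r' where r': "(\<lambda>z. r' - (- p z)) \<in> M"
      using assms(2) real_polynomial_function_minus[OF p] M(3) unfolding archimedean_def by blast
    define S where "S = {c. (\<lambda>z. p z - c) \<in> M}"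
    have "- r' \<in> S" using r' by (simp add: S_def add.commute)
    have le: "c \<le> d" if "c \<in> S" "(\<lambda>z. d - p z) \<in> M" for c d
    proof -
      have "(\<lambda>z. d - c) \<in> M"
        by (rule member_pointwise[OF module_add[OF M(1), of "\<lambda>z. p z - c" "\<lambda>z. d - p z"]])
           (use that in \<open>auto simp: S_def\<close>)
      then show ?thesis using const by force
    qed
    have bdd: "bdd_above S" using le[OF _ r] by (rule bdd_aboveI)
    show ?thesis
      unfolding val_def
    proof (intro exI[of _ "Sup S"] conjI allI impI p)
      fix \<epsilon> :: real assume "\<epsilon> > 0"
      then have "Sup S + \<epsilon> \<notin> S" using cSup_upper[OF _ bdd] by force
      then have "(\<lambda>z. - (p z - (Sup S + \<epsilon>))) \<in> M"
        using total[OF real_polynomial_function_diff[OF p real_polynomial_function.intros(2)], of "Sup S + \<epsilon>"]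
        unfolding S_def by blast
      then show "(\<lambda>z. Sup S + \<epsilon> - p z) \<in> M" by simp
      obtain c where c: "c \<in> S" "Sup S - \<epsilon> < c"
        using less_cSupE[of "Sup S - \<epsilon>" S] \<open>\<epsilon> > 0\<close> \<open>- r' \<in> S\<close> by auto
      show "(\<lambda>z. p z - Sup S + \<epsilon>) \<in> M"
        by (rule member_pointwise[OF module_add[OF M(1), of "\<lambda>z. p z - c" "\<lambda>_. c - (Sup S - \<epsilon>)"]])
           (use c module_const[OF M(1), of "c - (Sup S - \<epsilon>)"] in \<open>auto simp: S_def\<close>)
    qed
  qed
  have val_const: "val (\<lambda>_. c) c" for c
    unfolding val_def by (auto intro: module_const[OF M(1)])
  have val_add: "val (\<lambda>z. p z + q z) (c + d)" if pq: "val p c" "val q d" for p q c d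
    unfolding val_def
  proof (intro conjI allI impI)
    show "real_polynomial_function (\<lambda>z. p z + q z)" using pq unfolding val_def by auto
    fix \<epsilon> :: real assume "\<epsilon> > 0"
    then have *: "(\<lambda>z. c + \<epsilon>/2 - p z) \<in> M" "(\<lambda>z. d + \<epsilon>/2 - q z) \<in> M"
        "(\<lambda>z. p z - c + \<epsilon>/2) \<in> M" "(\<lambda>z. q z - d + \<epsilon>/2) \<in> M"
      using pq half_gt_zero unfolding val_def by blast+
    show "(\<lambda>z. c + d + \<epsilon> - (p z + q z)) \<in> M"
      by (rule member_pointwise[OF module_add[OF M(1) *(1,2)]]) auto
    show "(\<lambda>z. p z + q z - (c + d) + \<epsilon>) \<in> M"
      by (rule member_pointwise[OF module_add[OF M(1) *(3,4)]]) auto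
  qed
  have val_scale: "val (\<lambda>z. k * p z) (k * c)" if p: "val p c" for p c k
    unfolding val_def
  proof (intro conjI allI impI)
    show "real_polynomial_function (\<lambda>z. k * p z)" using p unfolding val_def by auto
    fix \<epsilon> :: real assume "\<epsilon> > 0"
    then have "\<epsilon> / (\<bar>k\<bar> + 1) > 0" by simp
    then have *: "(\<lambda>z. c + \<epsilon> / (\<bar>k\<bar> + 1) - p z) \<in> M" "(\<lambda>z. p z - c + \<epsilon> / (\<bar>k\<bar> + 1)) \<in> M"
      using p unfolding val_def by blast+
    have "0 \<le> \<epsilon> - \<bar>k\<bar> * (\<epsilon> / (\<bar>k\<bar> + 1))" using \<open>\<epsilon> > 0\<close> by (simp add: field_simps)
    note rest = module_const[OF M(1) this]
    note ** = module_add[OF M(1) module_scale[OF M(1) *(1), of "\<bar>k\<bar>"] rest]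
      module_add[OF M(1) module_scale[OF M(1) *(2), of "\<bar>k\<bar>"] rest]
    have "(\<lambda>z. \<bar>k\<bar> * c - \<bar>k\<bar> * p z + \<epsilon>) \<in> M" "(\<lambda>z. \<bar>k\<bar> * p z - \<bar>k\<bar> * c + \<epsilon>) \<in> M"
      by (rule member_pointwise[OF **(1)], simp_all add: right_diff_distrib distrib_left)
         (rule member_pointwise[OF **(2)], simp_all add: right_diff_distrib distrib_left)
    then show "(\<lambda>z. k * c + \<epsilon> - k * p z) \<in> M" "(\<lambda>z. k * p z - k * c + \<epsilon>) \<in> M"
      by (cases "k \<ge> 0"; simp add: algebra_simps)+
  qed
  have val_square: "(\<lambda>z. \<epsilon> - (a z)\<^sup>2) \<in> M" if a: "val a 0" "\<epsilon> > 0" for a \<epsilon>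
    using module_minus_square[OF M(1), of a "sqrt \<epsilon>"] a unfolding val_def
    by (simp add: add.commute)
  \<comment> \<open>Members that give the bounds are $\epsilon \pm ab = ((\epsilon - a^2) + (\epsilon - b^2) + (a \pm b)^2)/2$.\<close>
  have val_mult_zero: "val (\<lambda>z. a z * b z) 0" if ab: "val a 0" "val b 0" for a b
    unfolding val_def
  proof (intro conjI allI impI)
    show "real_polynomial_function (\<lambda>z. a z * b z)" using ab unfolding val_def by auto
    fix \<epsilon> :: real assume "\<epsilon> > 0"
    have sq: "(\<lambda>z. (a z + b z)\<^sup>2) \<in> M" "(\<lambda>z. (a z - b z)\<^sup>2) \<in> M"
      using ab unfolding val_def by (auto intro!: module_square[OF M(1)])
    note * = module_add[OF M(1) val_square[OF ab(1) \<open>\<epsilon> > 0\<close>] val_square[OF ab(2) \<open>\<epsilon> > 0\<close>]]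
    show "(\<lambda>z. 0 + \<epsilon> - a z * b z) \<in> M"
      by (rule member_pointwise[OF module_scale[OF M(1) module_add[OF M(1) * sq(2)], of "1/2"]])
         (auto simp: power2_eq_square algebra_simps)
    show "(\<lambda>z. a z * b z - 0 + \<epsilon>) \<in> M"
      by (rule member_pointwise[OF module_scale[OF M(1) module_add[OF M(1) * sq(1)], of "1/2"]])
         (auto simp: power2_eq_square algebra_simps)
  qed
  have val_mult: "val (\<lambda>z. p z * q z) (c * d)" if pq: "val p c" "val q d" for p q c d
  proof -
    have "val (\<lambda>z. p z + - c) (c + - c)" "val (\<lambda>z. q z + - d) (d + - d)"
      by (intro val_add val_const pq)+
    then have "val (\<lambda>z. (p z + - c) * (q z + - d)) 0" using val_mult_zero by simp
    then have "val (\<lambda>z. (p z + - c) * (q z + - d) + (c * q z + (d * p z + - (c * d))))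
       (0 + (c * d + (d * c + - (c * d))))"
      by (intro val_add val_scale val_const pq)
    moreover have "(\<lambda>z. (p z + - c) * (q z + - d) + (c * q z + (d * p z + - (c * d)))) = (\<lambda>z. p z * q z)"
      by (auto simp: algebra_simps)
    ultimately show ?thesis by (simp add: algebra_simps)
  qed
  obtain \<xi> where \<xi>: "\<And>b. val (\<lambda>z. z \<bullet> b) (\<xi> b)"
    using val_ex[OF real_polynomial_function.intros(1)[OF bounded_linear_inner_left]] by metis
  define z :: 'a where "z = (\<Sum>b\<in>Basis. \<xi> b *\<^sub>R b)"
  have z: "z \<bullet> b = \<xi> b" if "b \<in> Basis" for b
    using that unfolding z_def by simp
  have val_sum: "val (\<lambda>z. \<Sum>i\<in>I. f i z) (\<Sum>i\<in>I. c i)"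
    if "finite I" "\<And>i. i \<in> I \<Longrightarrow> val (f i) (c i)" for I :: "'a set" and f c
    using that by induction (auto intro: val_const val_add)
  have val_eval: "val p (p z)" if "real_polynomial_function p" for p
    using that
  proof (induction rule: real_polynomial_function.induct)
    case (linear f)
    have f: "f y = (\<Sum>b\<in>Basis. (f b) * (y \<bullet> b))" for y
      by (rule bounded_linear_eq_sum_Basis[OF linear])
    have "val (\<lambda>y. \<Sum>b\<in>Basis. (f b) * (y \<bullet> b)) (\<Sum>b\<in>Basis. (f b) * (z \<bullet> b))"
      by (intro val_sum val_scale finite_Basis) (simp add: z \<xi>)
    then show ?case unfolding f[symmetric] .
  qed (auto intro: val_const val_add val_mult)
  show thesis
  proof (rule that)
    fix p assume p: "p \<in> Q"
    then have v: "val p (p z)" using val_eval module_polynomial[OF assms(1)] by blast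
    show "0 \<le> p z"
    proof (rule field_le_epsilon)
      fix \<epsilon> :: real assume "\<epsilon> > 0"
      then have "(\<lambda>y. p z + \<epsilon> - p y) \<in> M" using v unfolding val_def by blast
      from module_add[OF M(1) this, of p] have "(\<lambda>_. p z + \<epsilon>) \<in> M" using p M(3) by auto
      then show "0 \<le> p z + \<epsilon>" by (rule const)
    qed
  qed
qed

text \<open>
  If $-a$ is adjoined to the module, no point is left where all members are nonnegative. So $-1$
  becomes a member, which means that $sa - 1$ lies in \<open>Q\<close> for some sum of squares $s$. To remove
  the factor $s$, start from a large \<open>r\<close> with $a + r$ in \<open>Q\<close> and lower it by $1/k^2$
  again and again: for $r \ge 0$ each summand on the left of
  $$(k-s)^2(a+r) + 2k(sa-1) + rs(2k-s) + (2k-1-s^2a) = k^2(a+r) - 1$$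
  belongs to \<open>Q\<close> once \<open>k\<close> is large, whatever \<open>r\<close> is. Finitely many steps make \<open>r\<close>
  nonpositive.
\<close>

lemma archimedean_positivstellensatz:
  fixes Q :: "('a::euclidean_space \<Rightarrow> real) set"
  assumes Q: "quadratic_module Q" and arch: "archimedean Q"
    and a: "real_polynomial_function a"
    and pos: "\<And>z. (\<And>p. p \<in> Q \<Longrightarrow> 0 \<le> p z) \<Longrightarrow> 0 < a z"
  shows "a \<in> Q"
proof -
  define b where "b = (\<lambda>z. - a z)"
  have b: "real_polynomial_function b" using a unfolding b_def by auto
  note sup = adjoin_superset[OF Q, of b]
  have "(\<lambda>_. -1) \<in> adjoin Q b"
  proof (rule ccontr)
    assume "(\<lambda>_. -1) \<notin> adjoin Q b"
    moreover have "archimedean (adjoin Q b)"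
      using arch sup unfolding archimedean_def by blast
    ultimately obtain z where z: "\<And>p. p \<in> adjoin Q b \<Longrightarrow> 0 \<le> p z"
      using archimedean_module_has_point[OF adjoin_quadratic_module[OF Q b]] by blast
    have "0 < a z" using pos z sup by blast
    moreover have "0 \<le> b z" using z adjoin_member[OF Q] by blast
    ultimately show False unfolding b_def by simp
  qed
  then obtain q s where q: "q \<in> Q" and s: "sum_of_squares s" and "\<And>z. - 1 = q z + s z * b z"
    unfolding adjoin_def by (auto dest: fun_cong)
  then have q_eq: "q z = s z * a z - 1" for z
    unfolding b_def by (simp add: algebra_simps)
  note s_poly = sum_of_squares_polynomial[OF s]
  obtain r\<^sub>1 where r1: "(\<lambda>z. r\<^sub>1 - s z) \<in> Q" using arch s_poly unfolding archimedean_def by blast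
  have "real_polynomial_function (\<lambda>z. (s z)\<^sup>2 * a z)" using s_poly a by auto
  then obtain r\<^sub>2 where r2: "(\<lambda>z. r\<^sub>2 - (s z)\<^sup>2 * a z) \<in> Q" using arch unfolding archimedean_def by blast
  obtain r\<^sub>3 where r3: "(\<lambda>z. r\<^sub>3 - b z) \<in> Q" using arch b unfolding archimedean_def by blast
  define k where "k = \<bar>r\<^sub>1\<bar> + \<bar>r\<^sub>2\<bar> + 1"
  have k: "k > 0" "(\<lambda>z. 2 * k - s z) \<in> Q" "(\<lambda>z. 2 * k - 1 - (s z)\<^sup>2 * a z) \<in> Q"
    by (auto simp: k_def intro!: module_const_minus_mono[OF Q r1] module_const_minus_mono[OF Q r2])
  have step: "(\<lambda>z. a z + (r - 1 / k\<^sup>2)) \<in> Q" if r: "(\<lambda>z. a z + r) \<in> Q" "0 \<le> r" for r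
  proof -
    have "(\<lambda>z. (k - s z)\<^sup>2 * (a z + r) + 2 * k * q z + r * (s z * (2 * k - s z))
        + (2 * k - 1 - (s z)\<^sup>2 * a z)) \<in> Q"
    proof -
      have "(\<lambda>z. (k - s z)\<^sup>2 * (a z + r)) \<in> Q"
        using s_poly by (intro module_times_square[OF Q r(1)]) auto
      moreover have "(\<lambda>z. 2 * k * q z) \<in> Q"
        using k(1) by (intro module_scale[OF Q q]) auto
      moreover have "(\<lambda>z. r * (s z * (2 * k - s z))) \<in> Q"
        by (intro module_scale[OF Q] module_times_sum_of_squares[OF Q] k(2) s r(2))
      ultimately show ?thesis
        using k(3) by (intro module_add[OF Q])
    qed
    from module_scale[OF Q this, of "1 / k\<^sup>2"] show ?thesis
    proof (rule member_pointwise)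
      fix z
      have "(k - s z)\<^sup>2 * (a z + r) + 2 * k * q z + r * (s z * (2 * k - s z))
        + (2 * k - 1 - (s z)\<^sup>2 * a z) = k\<^sup>2 * (a z + r) - 1"
        unfolding q_eq by algebra
      then show "a z + (r - 1 / k\<^sup>2) = 1 / k\<^sup>2 * ((k - s z)\<^sup>2 * (a z + r) + 2 * k * q z +
          r * (s z * (2 * k - s z)) + (2 * k - 1 - (s z)\<^sup>2 * a z))"
        using k(1) by (simp add: field_simps)
    qed simp
  qed
  have finish: "a \<in> Q" if "(\<lambda>z. a z + r) \<in> Q" "r \<le> 0" for r
    by (rule member_pointwise[OF module_add[OF Q that(1) module_const[OF Q, of "- r"]]])
       (use that in auto)
  have "a \<in> Q \<or> (\<lambda>z. a z + (r\<^sub>3 - of_nat n * (1 / k\<^sup>2))) \<in> Q" for n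
  proof (induction n)
    case 0
    show ?case using r3 by (simp add: b_def add.commute)
  next
    case (Suc n)
    show ?case
    proof (cases "a \<in> Q")
      case False
      then have *: "(\<lambda>z. a z + (r\<^sub>3 - of_nat n * (1 / k\<^sup>2))) \<in> Q" using Suc by blast
      then have "r\<^sub>3 - of_nat n * (1 / k\<^sup>2) \<ge> 0" using finish False by force
      from step[OF * this] show ?thesis by (simp add: algebra_simps add_divide_distrib)
    qed simp
  qed
  moreover obtain n where "r\<^sub>3 < of_nat n * (1 / k\<^sup>2)"
    using reals_Archimedean3[of "1 / k\<^sup>2"] k(1) by auto
  ultimately show ?thesis using finish[of "r\<^sub>3 - of_nat n * (1 / k\<^sup>2)"] by fastforce
qed

section \<open>Polynomials of bounded degree\<close>

text \<open>
  The exponents may repeat along the family; collecting equal ones brings the sum into the normal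
  form that \<^const>\<open>poly_space\<close> asks for. Sums and products of polynomials produce such families.
\<close>

lemma poly_space_finite_sum:
  fixes \<alpha> :: "'i \<Rightarrow> 'a::euclidean_space \<Rightarrow> nat"
  assumes I: "finite I" and deg: "\<And>i. i \<in> I \<Longrightarrow> (\<Sum>b\<in>Basis. \<alpha> i b) \<le> d"
  shows "(\<lambda>z. \<Sum>i\<in>I. c i * (\<Prod>b\<in>Basis. (z \<bullet> b) ^ \<alpha> i b)) \<in> poly_space d"
proof -
  have "(\<Sum>i\<in>I. c i * (\<Prod>b\<in>Basis. (z \<bullet> b) ^ \<alpha> i b)) =
      (\<Sum>\<beta>\<in>\<alpha> ` I. (\<Sum>i\<in>{i \<in> I. \<alpha> i = \<beta>}. c i) * (\<Prod>b\<in>Basis. (z \<bullet> b) ^ \<beta> b))" for z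
    unfolding sum_distrib_right by (subst sum.image_gen[OF I, of _ \<alpha>]) (auto intro!: sum.cong)
  then show ?thesis
    unfolding poly_space_def using I deg
    by (intro CollectI exI[of _ "\<alpha> ` I"] exI[of _ "\<lambda>\<beta>. \<Sum>i\<in>{i \<in> I. \<alpha> i = \<beta>}. c i"]) auto
qed

lemma poly_space_mono: "d \<le> e \<Longrightarrow> poly_space d \<subseteq> poly_space e"
  unfolding poly_space_def by (blast intro: order_trans)

lemma poly_space_add:
  fixes p :: "'a::euclidean_space \<Rightarrow> real"
  assumes "p \<in> poly_space d" "q \<in> poly_space d"
  shows "(\<lambda>z. p z + q z) \<in> poly_space d"
proof -
  obtain A c where A: "finite A" "\<forall>\<alpha>\<in>A. (\<Sum>b\<in>Basis. \<alpha> b) \<le> d"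
      "p = (\<lambda>z. \<Sum>\<alpha>\<in>A. c \<alpha> * (\<Prod>b\<in>Basis. (z \<bullet> b) ^ \<alpha> b))"
    using assms(1) unfolding poly_space_def by blast
  obtain B e where B: "finite B" "\<forall>\<alpha>\<in>B. (\<Sum>b\<in>Basis. \<alpha> b) \<le> d"
      "q = (\<lambda>z. \<Sum>\<alpha>\<in>B. e \<alpha> * (\<Prod>b\<in>Basis. (z \<bullet> b) ^ \<alpha> b))"
    using assms(2) unfolding poly_space_def by blast
  have "(\<lambda>z. \<Sum>i\<in>A <+> B. case_sum c e i * (\<Prod>b\<in>Basis. (z \<bullet> b) ^ case_sum id id i b)) \<in> poly_space d"
    using A B by (intro poly_space_finite_sum) auto
  then show ?thesis using A B by (simp add: sum.Plus)
qed

lemma poly_space_mult: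
  fixes p :: "'a::euclidean_space \<Rightarrow> real"
  assumes "p \<in> poly_space d" "q \<in> poly_space e"
  shows "(\<lambda>z. p z * q z) \<in> poly_space (d + e)"
proof -
  obtain A c where A: "finite A" "\<forall>\<alpha>\<in>A. (\<Sum>b\<in>Basis. \<alpha> b) \<le> d"
      "p = (\<lambda>z. \<Sum>\<alpha>\<in>A. c \<alpha> * (\<Prod>b\<in>Basis. (z \<bullet> b) ^ \<alpha> b))"
    using assms(1) unfolding poly_space_def by blast
  obtain B c' where B: "finite B" "\<forall>\<alpha>\<in>B. (\<Sum>b\<in>Basis. \<alpha> b) \<le> e"
      "q = (\<lambda>z. \<Sum>\<alpha>\<in>B. c' \<alpha> * (\<Prod>b\<in>Basis. (z \<bullet> b) ^ \<alpha> b))"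
    using assms(2) unfolding poly_space_def by blast
  have "(\<lambda>z. \<Sum>i\<in>A \<times> B. (c (fst i) * c' (snd i)) *
      (\<Prod>b\<in>Basis. (z \<bullet> b) ^ (fst i b + snd i b))) \<in> poly_space (d + e)"
    using A B by (intro poly_space_finite_sum) (auto simp: sum.distrib intro: add_mono)
  moreover have "p z * q z = (\<Sum>i\<in>A \<times> B. (c (fst i) * c' (snd i)) *
      (\<Prod>b\<in>Basis. (z \<bullet> b) ^ (fst i b + snd i b)))" for z
    unfolding A(3) B(3) sum_product sum.cartesian_product
    by (auto intro!: sum.cong simp: power_add prod.distrib)
  ultimately show ?thesis by simp
qed

lemma poly_space_polynomial: "p \<in> poly_space d \<Longrightarrow> real_polynomial_function p"
  unfolding poly_space_def
  by (auto intro!: real_polynomial_function_sum real_polynomial_function.intros(2,4)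
      real_polynomial_function_prod real_polynomial_function_power
      real_polynomial_function.intros(1)[OF bounded_linear_inner_left])

lemma polynomial_in_poly_space:
  fixes p :: "'a::euclidean_space \<Rightarrow> real"
  assumes "real_polynomial_function p"
  shows "\<exists>d. p \<in> poly_space d"
  using assms
proof (induction rule: real_polynomial_function.induct)
  case (linear f)
  have "(\<lambda>z. \<Sum>i\<in>Basis. f i * (\<Prod>b\<in>Basis. (z \<bullet> b) ^ (if b = i then 1 else 0))) \<in> poly_space 1"
    by (intro poly_space_finite_sum) auto
  moreover have "(\<Prod>b\<in>Basis. (z \<bullet> b) ^ (if b = i then 1 else 0)) = z \<bullet> i" if "i \<in> Basis" for z i :: 'a
  proof -
    have "(\<Prod>b\<in>Basis. (z \<bullet> b) ^ (if b = i then 1 else 0)) = (\<Prod>b\<in>Basis. if b = i then z \<bullet> b else 1)"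
      by (intro prod.cong) auto
    then show ?thesis using that by (simp add: prod.delta)
  qed
  ultimately have "(\<lambda>z. \<Sum>i\<in>Basis. f i * (z \<bullet> i)) \<in> poly_space 1"
    by (simp cong: sum.cong)
  moreover have "f = (\<lambda>z. \<Sum>i\<in>Basis. f i * (z \<bullet> i))"
    by (rule ext bounded_linear_eq_sum_Basis linear)+
  ultimately show ?case by metis
next
  case (const c)
  have "(\<lambda>z. \<Sum>i\<in>{()}. c * (\<Prod>b\<in>Basis. (z \<bullet> b) ^ 0)) \<in> poly_space 0"
    by (intro poly_space_finite_sum) auto
  then show ?case by auto
next
  case (add f g)
  then obtain d e where "f \<in> poly_space d" "g \<in> poly_space e" by blast
  then have "f \<in> poly_space (max d e)" "g \<in> poly_space (max d e)"
    using poly_space_mono[of _ "max d e"] by (meson max.cobounded1 max.cobounded2 subsetD)+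
  then show ?case using poly_space_add by blast
next
  case (mult f g)
  then show ?case using poly_space_mult by blast
qed

text \<open>
  The shift \<open>k\<close> stands for the degree of a generator, which lowers the degree available to its
  multiplier.
\<close>

lemma eventually_in_poly_space:
  assumes "real_polynomial_function p"
  shows "\<forall>\<^sub>F \<mu> in sequentially. p \<in> poly_space (\<mu> - k)"
proof -
  obtain d where d: "p \<in> poly_space d" using polynomial_in_poly_space[OF assms] by blast
  show ?thesis
  proof (rule eventually_sequentiallyI[of "d + k"])
    show "p \<in> poly_space (\<mu> - k)" if "d + k \<le> \<mu>" for \<mu>
    proof -
      have "d \<le> \<mu> - k" using that by linarith
      then show ?thesis using poly_space_mono d by blast
    qed
  qed
qed

lemma eventually_in_sos:
  assumes "sum_of_squares s"
  shows "\<forall>\<^sub>F \<mu> in sequentially. s \<in> sos (\<mu> - k)"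
proof -
  obtain qs where qs: "\<forall>q\<in>set qs. real_polynomial_function q" "s = (\<lambda>z. \<Sum>q\<leftarrow>qs. (q z)\<^sup>2)"
    using assms unfolding sum_of_squares_def by blast
  have "\<forall>\<^sub>F \<mu> in sequentially. \<forall>q\<in>set qs. q \<in> poly_space \<mu>"
    using eventually_in_poly_space[of _ 0] qs(1) by (intro eventually_ball_finite) auto
  then obtain N where N: "\<And>\<mu>. \<mu> \<ge> N \<Longrightarrow> \<forall>q\<in>set qs. q \<in> poly_space \<mu>"
    unfolding eventually_sequentially by blast
  show ?thesis
  proof (rule eventually_sequentiallyI[of "2 * N + k"])
    fix \<mu> assume "2 * N + k \<le> \<mu>"
    then have "set qs \<subseteq> poly_space ((\<mu> - k) div 2)" using N[of "(\<mu> - k) div 2"] by auto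
    then show "s \<in> sos (\<mu> - k)" using qs(2) unfolding sos_def by blast
  qed
qed

lemma sum_of_squares_nonneg: "sum_of_squares s \<Longrightarrow> 0 \<le> s z"
  unfolding sum_of_squares_def by (auto intro!: sum_list_nonneg)

lemma sos_sum_of_squares: "s \<in> sos \<mu> \<Longrightarrow> sum_of_squares s"
  unfolding sos_def sum_of_squares_def using poly_space_polynomial by blast

section \<open>Putinar's theorem for weighted sums of squares\<close>

text \<open>
  The union of the truncated cones \<^const>\<open>weighted_sos\<close> over all degrees. Multiplication by
  squares raises the degree, so the union is a quadratic module where a single cone is not.
\<close>

definition weighted_module ::
    "('a::euclidean_space \<Rightarrow> real) list \<Rightarrow> ('a \<Rightarrow> real) list \<Rightarrow> ('a \<Rightarrow> real) set" where
  "weighted_module fs gs = {p. \<exists>\<sigma>\<^sub>0 \<sigma> \<rho>. sum_of_squares \<sigma>\<^sub>0 \<and>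
     (\<forall>i<length fs. sum_of_squares (\<sigma> i)) \<and> (\<forall>i<length gs. real_polynomial_function (\<rho> i)) \<and>
     p = (\<lambda>z. \<sigma>\<^sub>0 z + (\<Sum>i<length fs. (fs ! i) z * \<sigma> i z) + (\<Sum>i<length gs. (gs ! i) z * \<rho> i z))}"

lemma weighted_moduleI:
  assumes "sum_of_squares \<sigma>\<^sub>0" "\<And>i. i < length fs \<Longrightarrow> sum_of_squares (\<sigma> i)"
    "\<And>i. i < length gs \<Longrightarrow> real_polynomial_function (\<rho> i)"
    "\<And>z. p z = \<sigma>\<^sub>0 z + (\<Sum>i<length fs. (fs ! i) z * \<sigma> i z) + (\<Sum>i<length gs. (gs ! i) z * \<rho> i z)"
  shows "p \<in> weighted_module fs gs"
  unfolding weighted_module_def using assms by blast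

lemma weighted_moduleE:
  assumes "p \<in> weighted_module fs gs"
  obtains \<sigma>\<^sub>0 \<sigma> \<rho> where "sum_of_squares \<sigma>\<^sub>0" "\<forall>i<length fs. sum_of_squares (\<sigma> i)"
    "\<forall>i<length gs. real_polynomial_function (\<rho> i)"
    "p = (\<lambda>z. \<sigma>\<^sub>0 z + (\<Sum>i<length fs. (fs ! i) z * \<sigma> i z) + (\<Sum>i<length gs. (gs ! i) z * \<rho> i z))"
proof -
  obtain \<sigma>\<^sub>0 \<sigma> \<rho> where "sum_of_squares \<sigma>\<^sub>0" "\<forall>i<length fs. sum_of_squares (\<sigma> i)"
    "\<forall>i<length gs. real_polynomial_function (\<rho> i)"
    "p = (\<lambda>z. \<sigma>\<^sub>0 z + (\<Sum>i<length fs. (fs ! i) z * \<sigma> i z) + (\<Sum>i<length gs. (gs ! i) z * \<rho> i z))"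
    using assms unfolding weighted_module_def by blast
  then show thesis using that by blast
qed

lemma weighted_sos_subset_module: "weighted_sos fs gs \<mu> \<subseteq> weighted_module fs gs"
  unfolding weighted_sos_def weighted_module_def
  using sos_sum_of_squares poly_space_polynomial by blast

lemma eventually_in_weighted_sos:
  assumes "p \<in> weighted_module fs gs"
  shows "\<forall>\<^sub>F \<mu> in sequentially. p \<in> weighted_sos fs gs \<mu>"
proof -
  obtain \<sigma>\<^sub>0 \<sigma> \<rho> where *: "sum_of_squares \<sigma>\<^sub>0" "\<forall>i<length fs. sum_of_squares (\<sigma> i)"
    "\<forall>i<length gs. real_polynomial_function (\<rho> i)"
    and p: "p = (\<lambda>z. \<sigma>\<^sub>0 z + (\<Sum>i<length fs. (fs ! i) z * \<sigma> i z) + (\<Sum>i<length gs. (gs ! i) z * \<rho> i z))"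
    using assms by (rule weighted_moduleE)
  have "\<forall>\<^sub>F \<mu> in sequentially. \<forall>i\<in>{..<length fs}. \<sigma> i \<in> sos (\<mu> - poly_degree (fs ! i))"
    using *(2) eventually_in_sos by (intro eventually_ball_finite) auto
  moreover have "\<forall>\<^sub>F \<mu> in sequentially. \<forall>i\<in>{..<length gs}. \<rho> i \<in> poly_space (\<mu> - poly_degree (gs ! i))"
    using *(3) eventually_in_poly_space by (intro eventually_ball_finite) auto
  moreover have "\<forall>\<^sub>F \<mu> in sequentially. \<sigma>\<^sub>0 \<in> sos \<mu>"
    using eventually_in_sos[OF *(1), of 0] by simp
  ultimately show ?thesis
    by eventually_elim (unfold weighted_sos_def p, blast)
qed

lemma weighted_module_nonneg:
  assumes "p \<in> weighted_module fs gs" "z \<in> semialgebraic_set fs gs"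
  shows "0 \<le> p z"
  using assms(1)
proof (rule weighted_moduleE)
  fix \<sigma>\<^sub>0 \<sigma> \<rho>
  assume "sum_of_squares \<sigma>\<^sub>0" and \<sigma>: "\<forall>i<length fs. sum_of_squares (\<sigma> i)"
    and p: "p = (\<lambda>z. \<sigma>\<^sub>0 z + (\<Sum>i<length fs. (fs ! i) z * \<sigma> i z) + (\<Sum>i<length gs. (gs ! i) z * \<rho> i z))"
  have "0 \<le> (\<Sum>i<length fs. (fs ! i) z * \<sigma> i z)"
    using assms(2) \<sigma> unfolding semialgebraic_set_def
    by (auto intro!: sum_nonneg mult_nonneg_nonneg sum_of_squares_nonneg[of "\<sigma> _"])
  moreover have "(\<Sum>i<length gs. (gs ! i) z * \<rho> i z) = 0"
    using assms(2) unfolding semialgebraic_set_def by (intro sum.neutral) auto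
  ultimately show ?thesis
    using p sum_of_squares_nonneg[OF \<open>sum_of_squares \<sigma>\<^sub>0\<close>, of z] by simp
qed

lemma inequality_in_weighted_module:
  assumes "f \<in> set fs"
  shows "f \<in> weighted_module fs gs"
proof -
  obtain j where j: "j < length fs" "f = fs ! j" using assms by (auto simp: in_set_conv_nth)
  show ?thesis
    by (rule weighted_moduleI[of "\<lambda>_. 0" _ "\<lambda>i _. if i = j then 1 else 0" _ "\<lambda>_ _. 0"])
       (use j sum_of_squares_zero sum_of_squares_square[of "\<lambda>_. 1"] in
         \<open>auto simp: if_distrib[of "(*) _"] cong: if_cong\<close>)
qed

lemma equality_in_weighted_module:
  assumes "g \<in> set gs"
  shows "(\<lambda>z. c * g z) \<in> weighted_module fs gs"
proof -
  obtain j where j: "j < length gs" "g = gs ! j" using assms by (auto simp: in_set_conv_nth)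
  show ?thesis
    by (rule weighted_moduleI[of "\<lambda>_. 0" _ "\<lambda>_ _. 0" _ "\<lambda>i _. if i = j then c else 0"])
       (use j sum_of_squares_zero in \<open>auto simp: if_distrib[of "(*) _"] mult.commute cong: if_cong\<close>)
qed

lemma weighted_module_quadratic:
  fixes fs gs :: "('a::euclidean_space \<Rightarrow> real) list"
  assumes poly: "\<forall>f\<in>set fs \<union> set gs. real_polynomial_function f"
  shows "quadratic_module (weighted_module fs gs)"
  unfolding quadratic_module_def
proof (intro conjI ballI allI impI)
  fix p assume "p \<in> weighted_module fs gs"
  then show "real_polynomial_function p"
  proof (rule weighted_moduleE)
    fix \<sigma>\<^sub>0 \<sigma> \<rho>
    assume \<sigma>\<^sub>0: "sum_of_squares \<sigma>\<^sub>0" and \<sigma>: "\<forall>i<length fs. sum_of_squares (\<sigma> i)"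
      and \<rho>: "\<forall>i<length gs. real_polynomial_function (\<rho> i)"
      and p: "p = (\<lambda>z. \<sigma>\<^sub>0 z + (\<Sum>i<length fs. (fs ! i) z * \<sigma> i z) + (\<Sum>i<length gs. (gs ! i) z * \<rho> i z))"
    show ?thesis
      unfolding p using poly
      by (intro real_polynomial_function.intros(3) real_polynomial_function_sum
          real_polynomial_function.intros(4) sum_of_squares_polynomial[OF \<sigma>\<^sub>0]
          sum_of_squares_polynomial[OF \<sigma>[rule_format]] \<rho>[rule_format]) auto
  qed
next
  show "(\<lambda>_. 1) \<in> weighted_module fs gs"
    by (rule weighted_moduleI[of "\<lambda>_. 1" _ "\<lambda>_ _. 0" _ "\<lambda>_ _. 0"])
       (use sum_of_squares_zero sum_of_squares_square[of "\<lambda>_. 1"] in auto)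
next
  fix p p' assume p: "p \<in> weighted_module fs gs" and p': "p' \<in> weighted_module fs gs"
  obtain \<sigma>\<^sub>0 \<sigma> \<rho> where
    1: "sum_of_squares \<sigma>\<^sub>0" "\<forall>i<length fs. sum_of_squares (\<sigma> i)"
    "\<forall>i<length gs. real_polynomial_function (\<rho> i)"
    "p = (\<lambda>z. \<sigma>\<^sub>0 z + (\<Sum>i<length fs. (fs ! i) z * \<sigma> i z) + (\<Sum>i<length gs. (gs ! i) z * \<rho> i z))"
    using weighted_moduleE[OF p] .
  obtain \<sigma>\<^sub>0' \<sigma>' \<rho>' where
    2: "sum_of_squares \<sigma>\<^sub>0'" "\<forall>i<length fs. sum_of_squares (\<sigma>' i)"
    "\<forall>i<length gs. real_polynomial_function (\<rho>' i)"
    "p' = (\<lambda>z. \<sigma>\<^sub>0' z + (\<Sum>i<length fs. (fs ! i) z * \<sigma>' i z) + (\<Sum>i<length gs. (gs ! i) z * \<rho>' i z))"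
    using weighted_moduleE[OF p'] .
  from 1 2 show "(\<lambda>z. p z + p' z) \<in> weighted_module fs gs"
    by (intro weighted_moduleI[of "\<lambda>z. \<sigma>\<^sub>0 z + \<sigma>\<^sub>0' z" _ "\<lambda>i z. \<sigma> i z + \<sigma>' i z" _ "\<lambda>i z. \<rho> i z + \<rho>' i z"])
       (auto intro: sum_of_squares_add simp: sum.distrib distrib_left)
next
  fix p q :: "'a \<Rightarrow> real" assume p: "p \<in> weighted_module fs gs" and q: "real_polynomial_function q"
  obtain \<sigma>\<^sub>0 \<sigma> \<rho> where
    "sum_of_squares \<sigma>\<^sub>0" "\<forall>i<length fs. sum_of_squares (\<sigma> i)"
    "\<forall>i<length gs. real_polynomial_function (\<rho> i)"
    "p = (\<lambda>z. \<sigma>\<^sub>0 z + (\<Sum>i<length fs. (fs ! i) z * \<sigma> i z) + (\<Sum>i<length gs. (gs ! i) z * \<rho> i z))"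
    using weighted_moduleE[OF p] .
  then show "(\<lambda>z. (q z)\<^sup>2 * p z) \<in> weighted_module fs gs"
    using q
    by (intro weighted_moduleI[of "\<lambda>z. (q z)\<^sup>2 * \<sigma>\<^sub>0 z" _ "\<lambda>i z. (q z)\<^sup>2 * \<sigma> i z" _ "\<lambda>i z. (q z)\<^sup>2 * \<rho> i z"])
       (auto intro: sum_of_squares_times_square simp: distrib_left sum_distrib_left mult.left_commute)
qed

text \<open>
  Putinar's theorem. At a point where the whole module is nonnegative, the generators
  satisfy the constraints: an equality constraint enters with both signs.
\<close>

lemma putinar_positivstellensatz:
  fixes fs gs :: "('a::euclidean_space \<Rightarrow> real) list"
  assumes poly: "\<forall>f\<in>set fs \<union> set gs. real_polynomial_function f"
    and ball: "(\<lambda>z. R - (norm z)\<^sup>2) \<in> set fs"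
    and p: "real_polynomial_function p" and pos: "\<And>z. z \<in> semialgebraic_set fs gs \<Longrightarrow> 0 < p z"
  shows "\<forall>\<^sub>F \<mu> in sequentially. p \<in> weighted_sos fs gs \<mu>"
proof (rule eventually_in_weighted_sos)
  note qm = weighted_module_quadratic[OF poly]
  show "p \<in> weighted_module fs gs"
  proof (rule archimedean_positivstellensatz[OF qm _ p])
    show "archimedean (weighted_module fs gs)"
      by (rule archimedean_if_ball[OF qm inequality_in_weighted_module[OF ball]])
    fix z :: 'a assume *: "\<And>q. q \<in> weighted_module fs gs \<Longrightarrow> 0 \<le> q z"
    have "0 \<le> 1 * g z" "0 \<le> - 1 * g z" if "g \<in> set gs" for g
      using *[OF equality_in_weighted_module[OF that, of _ fs]] by blast+
    then show "0 < p z"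
      using * inequality_in_weighted_module[of _ fs gs]
      by (intro pos) (force simp: semialgebraic_set_def)
  qed
qed

section \<open>Approximation in $C^1$ by Bernstein polynomials\<close>

lemma polynomial_has_derivative:
  fixes p :: "'a::euclidean_space \<Rightarrow> real"
  assumes "real_polynomial_function p"
  shows "\<exists>D. (\<forall>z. (p has_derivative D z) (at z)) \<and> (\<forall>v. real_polynomial_function (\<lambda>z. D z v))"
  using assms
proof (induction rule: real_polynomial_function.induct)
  case (linear f)
  then show ?case
    by (intro exI[of _ "\<lambda>_. f"]) (auto intro: bounded_linear_imp_has_derivative)
next
  case (const c)
  then show ?case by (intro exI[of _ "\<lambda>_ _. 0"]) auto
next
  case (add f g)
  then obtain D E where "\<forall>z. (f has_derivative D z) (at z)" "\<forall>v. real_polynomial_function (\<lambda>z. D z v)"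
    "\<forall>z. (g has_derivative E z) (at z)" "\<forall>v. real_polynomial_function (\<lambda>z. E z v)"
    by blast
  then show ?case
    by (intro exI[of _ "\<lambda>z v. D z v + E z v"]) (auto intro: has_derivative_add)
next
  case (mult f g)
  then obtain D E where "\<forall>z. (f has_derivative D z) (at z)" "\<forall>v. real_polynomial_function (\<lambda>z. D z v)"
    "\<forall>z. (g has_derivative E z) (at z)" "\<forall>v. real_polynomial_function (\<lambda>z. E z v)"
    by blast
  with mult.hyps show ?case
    by (intro exI[of _ "\<lambda>z v. f z * E z v + D z v * g z"]) (auto intro!: has_derivative_mult real_polynomial_function.intros(3,4))
qed

lemma Bernstein_variance:
  assumes "m > 0"
  shows "(\<Sum>k\<le>m. (real k / real m - x)\<^sup>2 * Bernstein m k x) = x * (1 - x) / real m"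
proof -
  have "(\<Sum>k\<le>m. (real k / real m - x)\<^sup>2 * Bernstein m k x) =
      (\<Sum>k\<le>m. (1 / (real m)\<^sup>2) * (real k * (real k - 1) * Bernstein m k x)
        + (1 / (real m)\<^sup>2 - 2 * x / real m) * (real k * Bernstein m k x) + x\<^sup>2 * Bernstein m k x)"
    using assms by (intro sum.cong) (auto simp: power2_eq_square field_simps)
  also have "\<dots> = (1 / (real m)\<^sup>2) * (real m * (real m - 1) * x\<^sup>2)
      + (1 / (real m)\<^sup>2 - 2 * x / real m) * (real m * x) + x\<^sup>2"
    unfolding sum.distrib sum_distrib_left[symmetric] by simp
  also have "\<dots> = x * (1 - x) / real m"
    using assms by (simp add: power2_eq_square field_simps)
  finally show ?thesis .
qed

lemma Bernstein_Suc_Suc_derivative: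
  "(Bernstein (Suc n) (Suc k) has_real_derivative
     real (Suc n) * (Bernstein n k x - Bernstein n (Suc k) x)) (at x)"
proof -
  have a: "real (Suc n choose Suc k) * real (Suc k) = real (Suc n) * real (n choose k)"
    using Suc_times_binomial_eq[of n k] by (metis of_nat_mult)
  have b: "real (Suc n choose Suc k) * real (n - k) = real (Suc n) * real (n choose Suc k)"
    using binomial_absorb_comp[of "Suc n" "Suc k"] by (metis diff_Suc_1 diff_Suc_Suc mult.commute of_nat_mult)
  define A B where "A = x ^ k * (1 - x) ^ (n - k)" and "B = x ^ Suc k * (1 - x) ^ (n - Suc k)"
  have "((\<lambda>x. x ^ Suc k) has_real_derivative real (Suc k) * x ^ k) (at x)"
    using DERIV_pow[of "Suc k" x] by simp
  moreover have "((\<lambda>x. 1 - x) has_real_derivative - 1) (at x)"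
    by (auto intro!: derivative_eq_intros)
  from DERIV_power[OF this, of "n - k"]
  have "((\<lambda>x. (1 - x) ^ (n - k)) has_real_derivative - (real (n - k) * (1 - x) ^ (n - Suc k))) (at x)"
    by simp
  ultimately have "((\<lambda>x. real (Suc n choose Suc k) * (x ^ Suc k * (1 - x) ^ (n - k))) has_real_derivative
      real (Suc n choose Suc k) * (real (Suc k) * x ^ k * (1 - x) ^ (n - k)
        + - (real (n - k) * (1 - x) ^ (n - Suc k)) * x ^ Suc k)) (at x)"
    by (intro DERIV_cmult DERIV_mult)
  moreover have "real (Suc n choose Suc k) * (real (Suc k) * x ^ k * (1 - x) ^ (n - k)
        + - (real (n - k) * (1 - x) ^ (n - Suc k)) * x ^ Suc k)
      = (real (Suc n choose Suc k) * real (Suc k)) * A - (real (Suc n choose Suc k) * real (n - k)) * B"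
    by (simp only: A_def B_def distrib_left mult_minus_left mult_minus_right mult_ac diff_conv_add_uminus)
  moreover have "\<dots> = real (Suc n) * (Bernstein n k x - Bernstein n (Suc k) x)"
    unfolding a b Bernstein_def A_def B_def by (simp only: right_diff_distrib mult_ac)
  moreover have "Bernstein (Suc n) (Suc k) =
      (\<lambda>x. real (Suc n choose Suc k) * (x ^ Suc k * (1 - x) ^ (n - k)))"
    by (rule ext) (simp only: Bernstein_def mult.assoc diff_Suc_Suc)
  ultimately show ?thesis by metis
qed

lemma Bernstein_zero_derivative:
  "(Bernstein (Suc n) 0 has_real_derivative - (real (Suc n) * Bernstein n 0 x)) (at x)"
proof -
  have "((\<lambda>x. 1 - x) has_real_derivative - 1) (at x)" by (auto intro!: derivative_eq_intros)
  from DERIV_power[OF this, of "Suc n"] show ?thesis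
    unfolding Bernstein_def[abs_def] by simp
qed

lemma Bernstein_sum_derivative:
  "((\<lambda>x. \<Sum>k\<le>Suc n. c k * Bernstein (Suc n) k x) has_real_derivative
     (\<Sum>k\<le>n. (real (Suc n) * (c (Suc k) - c k)) * Bernstein n k x)) (at x)"
proof -
  have zero: "Bernstein n (Suc n) x = 0" by (simp add: Bernstein_def)
  have shift: "c 0 * Bernstein n 0 x + (\<Sum>k\<le>n. c (Suc k) * Bernstein n (Suc k) x)
      = (\<Sum>k\<le>n. c k * Bernstein n k x)"
    using sum.atMost_Suc_shift[of "\<lambda>k. c k * Bernstein n k x" n]
    by (simp add: zero)
  have 1: "((\<lambda>x. c 0 * Bernstein (Suc n) 0 x + (\<Sum>k\<le>n. c (Suc k) * Bernstein (Suc n) (Suc k) x))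
      has_real_derivative c 0 * (- (real (Suc n) * Bernstein n 0 x)) + (\<Sum>k\<le>n. c (Suc k) *
        (real (Suc n) * (Bernstein n k x - Bernstein n (Suc k) x)))) (at x)"
    by (intro DERIV_add DERIV_sum DERIV_cmult Bernstein_Suc_Suc_derivative Bernstein_zero_derivative)
  have 2: "(\<Sum>k\<le>n. c (Suc k) * (real (Suc n) * (Bernstein n k x - Bernstein n (Suc k) x)))
      = real (Suc n) * ((\<Sum>k\<le>n. c (Suc k) * Bernstein n k x) - (\<Sum>k\<le>n. c (Suc k) * Bernstein n (Suc k) x))"
    by (simp add: sum_distrib_left flip: sum_subtractf) (simp add: algebra_simps)
  have 3: "(\<Sum>k\<le>n. (real (Suc n) * (c (Suc k) - c k)) * Bernstein n k x)
      = real (Suc n) * ((\<Sum>k\<le>n. c (Suc k) * Bernstein n k x) - (\<Sum>k\<le>n. c k * Bernstein n k x))"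
    by (simp add: sum_distrib_left flip: sum_subtractf) (simp add: algebra_simps)
  show ?thesis
    unfolding sum.atMost_Suc_shift 3 shift[symmetric]
    by (rule DERIV_cong[OF 1]) (unfold 2, algebra)
qed

text \<open>
  Tensor products of Bernstein polynomials on the unit cube, with a separate degree \<open>\<mu> b\<close> in every
  coordinate. Partial derivatives lower the degree in a single coordinate, hence the generality.
\<close>

definition Bernstein_index :: "('a::euclidean_space \<Rightarrow> nat) \<Rightarrow> ('a \<Rightarrow> nat) set" where
  "Bernstein_index \<mu> = PiE Basis (\<lambda>b. {..\<mu> b})"

definition Bernstein_weight ::
    "('a::euclidean_space \<Rightarrow> nat) \<Rightarrow> ('a \<Rightarrow> nat) \<Rightarrow> 'a \<Rightarrow> real" where
  "Bernstein_weight \<mu> k x = (\<Prod>b\<in>Basis. Bernstein (\<mu> b) (k b) (x \<bullet> b))"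

lemma finite_Bernstein_index: "finite (Bernstein_index \<mu>)"
  unfolding Bernstein_index_def by (intro finite_PiE) auto

lemma Bernstein_weight_nonneg: "x \<in> cbox 0 One \<Longrightarrow> 0 \<le> Bernstein_weight \<mu> k x"
  unfolding Bernstein_weight_def by (intro prod_nonneg Bernstein_nonneg) (auto simp: mem_box)

lemma sum_Bernstein_weight: "(\<Sum>k\<in>Bernstein_index \<mu>. Bernstein_weight \<mu> k x) = 1"
  unfolding Bernstein_weight_def Bernstein_index_def
  using prod_sum_PiE[of Basis "\<lambda>b. {..\<mu> b}" "\<lambda>b j. Bernstein (\<mu> b) j (x \<bullet> b)"] by simp

lemma sum_Bernstein_weight_marginal:
  assumes b: "b \<in> Basis"
  shows "(\<Sum>k\<in>Bernstein_index \<mu>. Bernstein_weight \<mu> k x * g (k b)) =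
    (\<Sum>j\<le>\<mu> b. g j * Bernstein (\<mu> b) j (x \<bullet> b))"
proof -
  define h where "h b' j = (if b' = b then g j else 1) * Bernstein (\<mu> b') j (x \<bullet> b')" for b' j
  have "(\<Prod>b'\<in>Basis. if b' = b then g (k b') else 1) = g (k b)" for k
    using b by (simp add: prod.delta)
  then have "(\<Sum>k\<in>Bernstein_index \<mu>. Bernstein_weight \<mu> k x * g (k b)) =
      (\<Sum>k\<in>PiE Basis (\<lambda>b. {..\<mu> b}). \<Prod>b'\<in>Basis. h b' (k b'))"
    unfolding Bernstein_weight_def Bernstein_index_def h_def prod.distrib by (simp add: mult.commute)
  also have "\<dots> = (\<Prod>b'\<in>Basis. \<Sum>j\<le>\<mu> b'. h b' j)"
    by (subst prod_sum_PiE) auto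
  also have "\<dots> = (\<Prod>b'\<in>Basis. if b' = b then (\<Sum>j\<le>\<mu> b. g j * Bernstein (\<mu> b) j (x \<bullet> b)) else 1)"
    by (intro prod.cong) (auto simp: h_def)
  also have "\<dots> = (\<Sum>j\<le>\<mu> b. g j * Bernstein (\<mu> b) j (x \<bullet> b))"
    using b by (simp add: prod.delta)
  finally show ?thesis .
qed

text \<open>
  The sample point \<open>\<eta> k\<close> may lie slightly off the grid point with coordinates
  \<open>k b / \<mu> b\<close>. This leaves room for the intermediate points of the mean value theorem
  when derivatives are approximated.
\<close>

definition Bernstein_averages_close :: "nat \<Rightarrow> ('a::euclidean_space \<Rightarrow> real) \<Rightarrow> real \<Rightarrow> bool" where
  "Bernstein_averages_close N h \<epsilon> \<longleftrightarrow>
    (\<forall>\<mu> \<eta> x. (\<forall>b\<in>Basis. N \<le> \<mu> b) \<longrightarrow> x \<in> cbox 0 One \<longrightarrow>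
      (\<forall>k\<in>Bernstein_index \<mu>. \<eta> k \<in> cbox 0 One \<and>
        (\<forall>b\<in>Basis. \<bar>\<eta> k \<bullet> b - real (k b) / real (\<mu> b)\<bar> \<le> 1 / real N)) \<longrightarrow>
      \<bar>(\<Sum>k\<in>Bernstein_index \<mu>. Bernstein_weight \<mu> k x * h (\<eta> k)) - h x\<bar> \<le> \<epsilon>)"

lemma Bernstein_averages_closeD:
  assumes "Bernstein_averages_close N h \<epsilon>" "\<And>b. b \<in> Basis \<Longrightarrow> N \<le> \<mu> b" "x \<in> cbox 0 One"
    "\<And>k. k \<in> Bernstein_index \<mu> \<Longrightarrow> \<eta> k \<in> cbox 0 One"
    "\<And>k b. k \<in> Bernstein_index \<mu> \<Longrightarrow> b \<in> Basis \<Longrightarrow>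
       \<bar>\<eta> k \<bullet> b - real (k b) / real (\<mu> b)\<bar> \<le> 1 / real N"
  shows "\<bar>(\<Sum>k\<in>Bernstein_index \<mu>. Bernstein_weight \<mu> k x * h (\<eta> k)) - h x\<bar> \<le> \<epsilon>"
  using assms unfolding Bernstein_averages_close_def by blast

text \<open>
  Chebyshev's argument: the weights are the probabilities of independent binomial variables, whose
  variance, scaled to the unit interval, is at most the reciprocal of the degree. So nearly all
  weight sits near \<open>x\<close>, where uniform continuity applies; boundedness of \<open>h\<close> controls the
  rest.
\<close>

lemma Bernstein_average_close:
  fixes h :: "'a::euclidean_space \<Rightarrow> real"
  assumes h: "continuous_on (cbox 0 One) h" and "\<epsilon> > 0"
  shows "\<exists>N>0. Bernstein_averages_close N h \<epsilon>"
proof -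
  have "bounded (h ` cbox 0 One)"
    using h compact_continuous_image compact_imp_bounded compact_cbox by blast
  then obtain M where M: "M > 0" "\<And>x. x \<in> cbox 0 One \<Longrightarrow> \<bar>h x\<bar> \<le> M"
    unfolding bounded_pos by force
  have "uniformly_continuous_on (cbox 0 One) h"
    using h by (intro compact_uniformly_continuous) auto
  then obtain \<delta> where \<delta>: "\<delta> > 0"
    "\<And>x y. x \<in> cbox 0 One \<Longrightarrow> y \<in> cbox 0 One \<Longrightarrow> dist y x < \<delta> \<Longrightarrow> dist (h y) (h x) < \<epsilon> / 2"
    unfolding uniformly_continuous_on_def using half_gt_zero[OF \<open>\<epsilon> > 0\<close>] by metis
  define K where "K = 2 * M / \<delta>\<^sup>2"
  have "K > 0" using M \<delta> by (simp add: K_def)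
  \<comment> \<open>Continuity near the diagonal and boundedness away from it, in a single quadratic bound
    whose expectation is a sum of variances.\<close>
  have close: "\<bar>h y - h x\<bar> \<le> \<epsilon> / 2 + K * (\<Sum>b\<in>Basis. (y \<bullet> b - x \<bullet> b)\<^sup>2)"
    if xy: "x \<in> cbox 0 One" "y \<in> cbox 0 One" for x y
  proof (cases "dist y x < \<delta>")
    case True
    then have "\<bar>h y - h x\<bar> \<le> \<epsilon> / 2" using \<delta>(2)[OF xy] by (simp add: dist_real_def)
    moreover have "0 \<le> K * (\<Sum>b\<in>Basis. (y \<bullet> b - x \<bullet> b)\<^sup>2)"
      using \<open>K > 0\<close> by (intro mult_nonneg_nonneg sum_nonneg) auto
    ultimately show ?thesis by linarith
  next
    case False
    have "(\<Sum>b\<in>Basis. (y \<bullet> b - x \<bullet> b)\<^sup>2) = (norm (y - x))\<^sup>2"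
      unfolding power2_norm_eq_inner euclidean_inner[of "y - x" "y - x"]
      by (simp add: power2_eq_square inner_diff_left)
    moreover have "\<delta>\<^sup>2 \<le> (norm (y - x))\<^sup>2"
      using False \<delta>(1) by (intro power_mono) (auto simp: dist_norm)
    ultimately have "K * \<delta>\<^sup>2 \<le> K * (\<Sum>b\<in>Basis. (y \<bullet> b - x \<bullet> b)\<^sup>2)"
      using \<open>K > 0\<close> by simp
    moreover have "K * \<delta>\<^sup>2 = 2 * M" using \<delta>(1) by (simp add: K_def)
    moreover have "\<bar>h y - h x\<bar> \<le> 2 * M" using M(2)[OF xy(1)] M(2)[OF xy(2)] by linarith
    ultimately show ?thesis using \<open>\<epsilon> > 0\<close> by linarith
  qed
  obtain N where N: "real N > 8 * K * real DIM('a) / \<epsilon>" "N > 0"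
    using reals_Archimedean2[of "max 0 (8 * K * real DIM('a) / \<epsilon>)"] by force
  have KN: "K * (real DIM('a) * (4 / real N)) \<le> \<epsilon> / 2"
    using N \<open>\<epsilon> > 0\<close> by (simp add: field_simps)
  have "\<bar>(\<Sum>k\<in>Bernstein_index \<mu>. Bernstein_weight \<mu> k x * h (\<eta> k)) - h x\<bar> \<le> \<epsilon>"
    if \<mu>: "\<forall>b\<in>Basis. N \<le> \<mu> b" and x: "x \<in> cbox 0 One"
      and \<eta>: "\<forall>k\<in>Bernstein_index \<mu>. \<eta> k \<in> cbox 0 One \<and>
         (\<forall>b\<in>Basis. \<bar>\<eta> k \<bullet> b - real (k b) / real (\<mu> b)\<bar> \<le> 1 / real N)" for \<mu> \<eta> x
  proof -
    define W where "W k = Bernstein_weight \<mu> k x" for k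
    note W = Bernstein_weight_nonneg[OF x, of \<mu>, folded W_def]
    have "(\<Sum>k\<in>Bernstein_index \<mu>. W k * h (\<eta> k)) - h x = (\<Sum>k\<in>Bernstein_index \<mu>. W k * (h (\<eta> k) - h x))"
      using sum_Bernstein_weight[of \<mu> x]
      by (simp add: W_def right_diff_distrib sum_subtractf flip: sum_distrib_right)
    also have "\<bar>\<dots>\<bar> \<le> (\<Sum>k\<in>Bernstein_index \<mu>. \<bar>W k * (h (\<eta> k) - h x)\<bar>)"
      by (rule sum_abs)
    also have "\<dots> \<le> (\<Sum>k\<in>Bernstein_index \<mu>. W k * (\<epsilon> / 2 + K * (\<Sum>b\<in>Basis.
        2 / real N + 2 * (real (k b) / real (\<mu> b) - x \<bullet> b)\<^sup>2)))"
    proof (rule sum_mono)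
      fix k assume k: "k \<in> Bernstein_index \<mu>"
      have "(\<eta> k \<bullet> b - x \<bullet> b)\<^sup>2 \<le> 2 / real N + 2 * (real (k b) / real (\<mu> b) - x \<bullet> b)\<^sup>2"
        if b: "b \<in> Basis" for b
      proof -
        define u v where "u = \<eta> k \<bullet> b - real (k b) / real (\<mu> b)" and "v = real (k b) / real (\<mu> b) - x \<bullet> b"
        have "\<bar>u\<bar> \<le> 1 / real N" using \<eta> k b unfolding u_def by blast
        then have "u\<^sup>2 \<le> (1 / real N)\<^sup>2" by (metis abs_ge_zero power2_abs power_mono)
        also have "\<dots> \<le> 1 / real N" using N(2) by (simp add: power2_eq_square field_simps)
        finally have "u\<^sup>2 \<le> 1 / real N" .
        moreover have "(u + v)\<^sup>2 \<le> 2 * u\<^sup>2 + 2 * v\<^sup>2"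
          using zero_le_power2[of "u - v"] by (simp add: power2_eq_square algebra_simps)
        moreover have "\<eta> k \<bullet> b - x \<bullet> b = u + v" by (simp add: u_def v_def)
        ultimately show ?thesis unfolding v_def[symmetric] by simp
      qed
      then have "(\<Sum>b\<in>Basis. (\<eta> k \<bullet> b - x \<bullet> b)\<^sup>2) \<le>
          (\<Sum>b\<in>Basis. 2 / real N + 2 * (real (k b) / real (\<mu> b) - x \<bullet> b)\<^sup>2)"
        by (rule sum_mono)
      then have "K * (\<Sum>b\<in>Basis. (\<eta> k \<bullet> b - x \<bullet> b)\<^sup>2) \<le>
          K * (\<Sum>b\<in>Basis. 2 / real N + 2 * (real (k b) / real (\<mu> b) - x \<bullet> b)\<^sup>2)"
        using \<open>K > 0\<close> by simp
      then have "\<bar>h (\<eta> k) - h x\<bar> \<le> \<epsilon> / 2 + K * (\<Sum>b\<in>Basis.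
          2 / real N + 2 * (real (k b) / real (\<mu> b) - x \<bullet> b)\<^sup>2)"
        using close[OF x, of "\<eta> k"] \<eta> k by force
      then show "\<bar>W k * (h (\<eta> k) - h x)\<bar> \<le> W k * (\<epsilon> / 2 + K * (\<Sum>b\<in>Basis.
          2 / real N + 2 * (real (k b) / real (\<mu> b) - x \<bullet> b)\<^sup>2))"
        using W[of k] by (simp add: abs_mult mult_left_mono)
    qed
    also have "\<dots> = \<epsilon> / 2 * (\<Sum>k\<in>Bernstein_index \<mu>. W k) + K * (\<Sum>b\<in>Basis.
        (\<Sum>k\<in>Bernstein_index \<mu>. W k * (2 / real N + 2 * (real (k b) / real (\<mu> b) - x \<bullet> b)\<^sup>2)))"
      by (subst sum.swap) (simp add: distrib_left sum.distrib sum_distrib_left mult.left_commute mult.commute)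
    also have "\<dots> \<le> \<epsilon> / 2 * 1 + K * (\<Sum>b\<in>(Basis::'a set). 4 / real N)"
    proof -
      have "(\<Sum>k\<in>Bernstein_index \<mu>. W k * (2 / real N + 2 * (real (k b) / real (\<mu> b) - x \<bullet> b)\<^sup>2)) \<le> 4 / real N"
        if b: "b \<in> Basis" for b
      proof -
        have "N \<le> \<mu> b" using \<mu> b by blast
        have "(\<Sum>k\<in>Bernstein_index \<mu>. W k * (2 / real N + 2 * (real (k b) / real (\<mu> b) - x \<bullet> b)\<^sup>2)) =
          (\<Sum>j\<le>\<mu> b. (2 / real N + 2 * (real j / real (\<mu> b) - x \<bullet> b)\<^sup>2) * Bernstein (\<mu> b) j (x \<bullet> b))"
          unfolding W_def by (rule sum_Bernstein_weight_marginal[OF b])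
        also have "\<dots> = 2 / real N * (\<Sum>j\<le>\<mu> b. Bernstein (\<mu> b) j (x \<bullet> b)) +
            2 * (\<Sum>j\<le>\<mu> b. (real j / real (\<mu> b) - x \<bullet> b)\<^sup>2 * Bernstein (\<mu> b) j (x \<bullet> b))"
          by (simp only: distrib_right sum.distrib sum_distrib_left mult.assoc)
        also have "\<dots> = 2 / real N + 2 * ((x \<bullet> b) * (1 - x \<bullet> b) / real (\<mu> b))"
          using Bernstein_variance[of "\<mu> b" "x \<bullet> b"] \<open>N \<le> \<mu> b\<close> N(2) by simp
        also have "\<dots> \<le> 2 / real N + 2 * (1 / real N)"
        proof -
          have "0 \<le> x \<bullet> b" "x \<bullet> b \<le> 1" using x b by (auto simp: mem_box)
          then have "(x \<bullet> b) * (1 - x \<bullet> b) \<le> 1" by (intro mult_le_one) auto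
          then have "(x \<bullet> b) * (1 - x \<bullet> b) / real (\<mu> b) \<le> 1 / real N"
            using \<open>N \<le> \<mu> b\<close> N(2) by (intro frac_le) auto
          then show ?thesis by simp
        qed
        finally show ?thesis by simp
      qed
      then show ?thesis
        using \<open>K > 0\<close> \<open>\<epsilon> > 0\<close> sum_Bernstein_weight[of \<mu> x] unfolding W_def
        by (intro add_mono mult_left_mono sum_mono) auto
    qed
    also have "\<dots> \<le> \<epsilon>" using KN by simp
    finally show ?thesis unfolding W_def .
  qed
  then show ?thesis using N(2) unfolding Bernstein_averages_close_def by blast
qed

definition node :: "nat \<Rightarrow> ('a::euclidean_space \<Rightarrow> nat) \<Rightarrow> 'a" where
  "node m k = (\<Sum>b\<in>Basis. (real (k b) / real m) *\<^sub>R b)"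

lemma node_inner: "b \<in> Basis \<Longrightarrow> node m k \<bullet> b = real (k b) / real m"
  by (simp add: node_def)

definition Bernstein_polynomial :: "nat \<Rightarrow> ('a::euclidean_space \<Rightarrow> real) \<Rightarrow> 'a \<Rightarrow> real" where
  "Bernstein_polynomial m f x = (\<Sum>k\<in>Bernstein_index (\<lambda>_. m). Bernstein_weight (\<lambda>_. m) k x * f (node m k))"

lemma Bernstein_polynomial_polynomial: "real_polynomial_function (Bernstein_polynomial m f)"
  unfolding Bernstein_polynomial_def[abs_def] Bernstein_weight_def Bernstein_def
  by (intro real_polynomial_function_sum finite_Bernstein_index real_polynomial_function.intros(2,4)
      real_polynomial_function_prod real_polynomial_function_power real_polynomial_function_diff
      real_polynomial_function.intros(1)[OF bounded_linear_inner_left] finite_Basis)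

lemma sum_Bernstein_index_split:
  fixes G :: "('a::euclidean_space \<Rightarrow> nat) \<Rightarrow> real"
  assumes i: "i \<in> Basis"
  shows "(\<Sum>k\<in>Bernstein_index \<mu>. G k) =
    (\<Sum>k\<in>PiE (Basis - {i}) (\<lambda>b. {..\<mu> b}). \<Sum>j\<le>\<mu> i. G (k(i := j)))"
proof -
  have "Bernstein_index \<mu> = PiE (insert i (Basis - {i})) (\<lambda>b. {..\<mu> b})"
    unfolding Bernstein_index_def using i by (simp add: insert_absorb)
  also have "\<dots> = (\<lambda>(j, k). k(i := j)) ` ({..\<mu> i} \<times> PiE (Basis - {i}) (\<lambda>b. {..\<mu> b}))"
    by (rule PiE_insert_eq)
  finally have "(\<Sum>k\<in>Bernstein_index \<mu>. G k) =
      (\<Sum>(j, k)\<in>{..\<mu> i} \<times> PiE (Basis - {i}) (\<lambda>b. {..\<mu> b}). G (k(i := j)))"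
    using sum.reindex[OF inj_combinator[of i "Basis - {i}" "\<lambda>b. {..\<mu> b}"], of G]
    by (simp add: case_prod_unfold)
  also have "\<dots> = (\<Sum>j\<le>\<mu> i. \<Sum>k\<in>PiE (Basis - {i}) (\<lambda>b. {..\<mu> b}). G (k(i := j)))"
    by (simp add: sum.cartesian_product)
  finally show ?thesis by (subst (asm) sum.swap)
qed

lemma Bernstein_weight_upd:
  assumes i: "i \<in> Basis"
  shows "Bernstein_weight \<mu> (k(i := j)) x =
    (\<Prod>b\<in>Basis - {i}. Bernstein (\<mu> b) (k b) (x \<bullet> b)) * Bernstein (\<mu> i) j (x \<bullet> i)"
  unfolding Bernstein_weight_def
  by (subst prod.remove[OF finite_Basis i]) (auto intro!: prod.cong)

text \<open>
  A partial derivative of a Bernstein polynomial is a Bernstein average of lower degree in that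
  coordinate, sampling the forward difference quotients of \<open>f\<close>.
\<close>

lemma Bernstein_polynomial_partial_derivative:
  fixes f :: "'a::euclidean_space \<Rightarrow> real"
  assumes i: "i \<in> Basis" and D: "(Bernstein_polynomial (Suc n) f has_derivative D) (at x)"
  shows "D i = (\<Sum>k\<in>Bernstein_index ((\<lambda>_. Suc n)(i := n)). Bernstein_weight ((\<lambda>_. Suc n)(i := n)) k x *
     (real (Suc n) * (f (node (Suc n) k + (1 / real (Suc n)) *\<^sub>R i) - f (node (Suc n) k))))"
    (is "_ = ?rhs")
proof -
  \<comment> \<open>On the line through \<open>x\<close> in direction \<open>i\<close> only one factor of each weight varies.\<close>
  define P where "P k = (\<Prod>b\<in>Basis - {i}. Bernstein (Suc n) (k b) (x \<bullet> b))" for k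
  define J where "J = PiE (Basis - {i}) (\<lambda>b. {..Suc n})"
  define c where "c k j = f (node (Suc n) (k(i := j)))" for k j
  have inner: "(x + s *\<^sub>R i) \<bullet> b = (if b = i then s else 0) + x \<bullet> b" if "b \<in> Basis" for b s
    using i that by (simp add: inner_add_left inner_Basis)
  have line: "Bernstein_polynomial (Suc n) f (x + s *\<^sub>R i) =
      (\<Sum>k\<in>J. P k * (\<Sum>j\<le>Suc n. c k j * Bernstein (Suc n) j (s + x \<bullet> i)))" for s
  proof -
    have "(\<Prod>b\<in>Basis - {i}. Bernstein (Suc n) (k b) ((x + s *\<^sub>R i) \<bullet> b)) = P k" for k
      unfolding P_def by (intro prod.cong) (auto simp: inner)
    then show ?thesis
      unfolding Bernstein_polynomial_def sum_Bernstein_index_split[OF i] Bernstein_weight_upd[OF i] J_def c_def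
      by (simp only: inner[OF i] if_True sum_distrib_left refl mult.assoc mult.commute[of "f _"])
  qed
  have "((\<lambda>s. x + s *\<^sub>R i) has_derivative (\<lambda>s. s *\<^sub>R i)) (at 0)"
    by (auto intro!: derivative_eq_intros)
  then have "((\<lambda>s. Bernstein_polynomial (Suc n) f (x + s *\<^sub>R i)) has_derivative (\<lambda>s. D (s *\<^sub>R i))) (at 0)"
    using D by (intro has_derivative_compose[of _ _ 0 UNIV "Bernstein_polynomial (Suc n) f" D]) auto
  moreover have "(\<lambda>s. D (s *\<^sub>R i)) = (*) (D i)"
    using has_derivative_bounded_linear[OF D] by (auto simp: linear_simps)
  ultimately have 1: "((\<lambda>s. Bernstein_polynomial (Suc n) f (x + s *\<^sub>R i)) has_real_derivative D i) (at 0)"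
    unfolding has_field_derivative_def by simp
  have "((\<lambda>s. \<Sum>j\<le>Suc n. c k j * Bernstein (Suc n) j (s + x \<bullet> i)) has_real_derivative
      (\<Sum>j\<le>n. (real (Suc n) * (c k (Suc j) - c k j)) * Bernstein n j (x \<bullet> i))) (at 0)" for k
    using Bernstein_sum_derivative[of "c k" n "0 + x \<bullet> i"] unfolding DERIV_shift by (simp only: add_0)
  then have 2: "((\<lambda>s. Bernstein_polynomial (Suc n) f (x + s *\<^sub>R i)) has_real_derivative
      (\<Sum>k\<in>J. P k * (\<Sum>j\<le>n. (real (Suc n) * (c k (Suc j) - c k j)) * Bernstein n j (x \<bullet> i)))) (at 0)"
    unfolding line by (intro DERIV_sum DERIV_cmult)
  have "c k (Suc j) = f (node (Suc n) (k(i := j)) + (1 / real (Suc n)) *\<^sub>R i)" for k j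
    unfolding c_def
    by (rule arg_cong[of _ _ f], rule euclidean_eqI)
       (use i in \<open>auto simp: node_inner inner_add_left inner_Basis add_divide_distrib\<close>)
  moreover have "?rhs = (\<Sum>k\<in>J. P k * (\<Sum>j\<le>n. (real (Suc n) *
      (f (node (Suc n) (k(i := j)) + (1 / real (Suc n)) *\<^sub>R i) - c k j)) * Bernstein n j (x \<bullet> i)))"
  proof -
    have "PiE (Basis - {i}) (\<lambda>b. {..((\<lambda>_. Suc n)(i := n)) b}) = J"
      unfolding J_def by (intro PiE_cong) auto
    moreover have "(\<Prod>b\<in>Basis - {i}. Bernstein (((\<lambda>_. Suc n)(i := n)) b) (k b) (x \<bullet> b)) = P k" for k
      unfolding P_def by (intro prod.cong) auto
    ultimately show ?thesis
      unfolding sum_Bernstein_index_split[OF i] Bernstein_weight_upd[OF i] c_def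
      by (simp only: fun_upd_same sum_distrib_left mult.assoc mult.commute[of "Bernstein n _ _"])
  qed
  ultimately show ?thesis using DERIV_unique[OF 1 2] by simp
qed

text \<open>
  By the mean value theorem the difference quotients sampled by a partial derivative of a Bernstein
  polynomial are values of the partial derivative of \<open>f\<close> close to the grid points. So both the
  Bernstein polynomials and their partial derivatives converge uniformly.
\<close>

lemma C1_approximation_unit_cube:
  fixes f :: "'a::euclidean_space \<Rightarrow> real"
  assumes f: "\<And>z. (f has_derivative G z) (at z)"
    and G: "\<And>b. b \<in> Basis \<Longrightarrow> continuous_on UNIV (\<lambda>z. G z b)" and "\<epsilon> > 0"
  shows "\<exists>p. real_polynomial_function p \<and> (\<forall>x\<in>cbox 0 One. \<bar>p x - f x\<bar> \<le> \<epsilon> \<and>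
    (\<forall>D. (p has_derivative D) (at x) \<longrightarrow> (\<forall>b\<in>Basis. \<bar>D b - G x b\<bar> \<le> \<epsilon>)))"
proof -
  have "continuous_on (cbox 0 One) f"
    by (intro continuous_at_imp_continuous_on ballI has_derivative_continuous[OF f])
  from Bernstein_average_close[OF this \<open>\<epsilon> > 0\<close>] obtain N
    where N: "N > 0" "Bernstein_averages_close N f \<epsilon>" by blast
  have "\<forall>i\<in>Basis. \<exists>N>0. Bernstein_averages_close N (\<lambda>x. G x i) \<epsilon>"
    using Bernstein_average_close[OF continuous_on_subset[OF G] \<open>\<epsilon> > 0\<close>] by blast
  then obtain M where M: "\<And>i. i \<in> Basis \<Longrightarrow> M i > 0"
    "\<And>i. i \<in> Basis \<Longrightarrow> Bernstein_averages_close (M i) (\<lambda>x. G x i) \<epsilon>"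
    by metis
  define n where "n = N + (\<Sum>i\<in>Basis. M i)"
  define m where "m = Suc n"
  have n: "N \<le> n" "n > 0" "\<And>i. i \<in> Basis \<Longrightarrow> M i \<le> n"
    using N(1) by (auto simp: n_def intro!: trans_le_add2 member_le_sum)
  have node_box: "node m k \<in> cbox 0 One" if "\<And>b. b \<in> Basis \<Longrightarrow> k b \<le> m" for k :: "'a \<Rightarrow> nat"
    using that by (auto simp: mem_box node_inner m_def divide_le_eq simp del: of_nat_Suc)
  have close: "\<bar>Bernstein_polynomial m f x - f x\<bar> \<le> \<epsilon>" if x: "x \<in> cbox 0 One" for x
    unfolding Bernstein_polynomial_def
    using n x node_box by (intro Bernstein_averages_closeD[OF N(2)]) (auto simp: m_def node_inner Bernstein_index_def PiE_iff)
  have partial: "\<bar>D i - G x i\<bar> \<le> \<epsilon>"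
    if x: "x \<in> cbox 0 One" and i: "i \<in> Basis"
      and D: "(Bernstein_polynomial m f has_derivative D) (at x)" for x i D
  proof -
    \<comment> \<open>The averages have degree \<open>n\<close> in direction \<open>i\<close>, but the nodes come from the grid of mesh
      \<open>h = 1/m\<close> with \<open>m = Suc n\<close>. The point \<open>\<eta> k\<close> and the grid point \<open>k i / n\<close> both lie in the
      cell that starts at \<open>k i / m\<close>, which is why they differ by at most \<open>h\<close>.\<close>
    define \<mu> where "\<mu> = (\<lambda>_::'a. m)(i := n)"
    define h where "h = 1 / real m"
    have "h > 0" "real m * h = 1" by (simp_all add: h_def m_def)
    have "\<exists>\<theta>. 0 < \<theta> \<and> \<theta> < h \<and> f (node m k + h *\<^sub>R i) - f (node m k) = h * G (node m k + \<theta> *\<^sub>R i) i" for k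
    proof -
      have "((\<lambda>s. f (node m k + s *\<^sub>R i)) has_real_derivative G (node m k + s *\<^sub>R i) i) (at s)" for s
      proof -
        have "((\<lambda>s. node m k + s *\<^sub>R i) has_derivative (\<lambda>s. s *\<^sub>R i)) (at s)"
          by (auto intro!: derivative_eq_intros)
        from has_derivative_compose[OF this f]
        have "((\<lambda>s. f (node m k + s *\<^sub>R i)) has_derivative (\<lambda>t. G (node m k + s *\<^sub>R i) (t *\<^sub>R i))) (at s)" .
        moreover have "(\<lambda>t. G (node m k + s *\<^sub>R i) (t *\<^sub>R i)) = (*) (G (node m k + s *\<^sub>R i) i)"
          using has_derivative_bounded_linear[OF f] by (auto simp: linear_simps)
        ultimately show ?thesis unfolding has_field_derivative_def by simp
      qed
      from MVT2[OF \<open>h > 0\<close> this] show ?thesis by auto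
    qed
    then obtain \<theta> where \<theta>: "\<And>k. 0 < \<theta> k" "\<And>k. \<theta> k < h"
      "\<And>k. f (node m k + h *\<^sub>R i) - f (node m k) = h * G (node m k + \<theta> k *\<^sub>R i) i"
      by metis
    define \<eta> where "\<eta> k = node m k + \<theta> k *\<^sub>R i" for k
    have \<eta>_inner: "\<eta> k \<bullet> b = real (k b) / real m + (if b = i then \<theta> k else 0)" if "b \<in> Basis" for k b
      using i that by (simp add: \<eta>_def inner_add_left node_inner inner_Basis)
    have "D i = (\<Sum>k\<in>Bernstein_index \<mu>. Bernstein_weight \<mu> k x *
        (real m * (f (node m k + h *\<^sub>R i) - f (node m k))))"
      unfolding \<mu>_def m_def h_def
      by (rule Bernstein_polynomial_partial_derivative[OF i D[unfolded m_def]])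
    also have "\<dots> = (\<Sum>k\<in>Bernstein_index \<mu>. Bernstein_weight \<mu> k x * G (\<eta> k) i)"
      unfolding \<theta>(3) \<eta>_def using \<open>real m * h = 1\<close> by (simp flip: mult.assoc)
    finally have D_eq: "D i = (\<Sum>k\<in>Bernstein_index \<mu>. Bernstein_weight \<mu> k x * G (\<eta> k) i)" .
    have "\<eta> k \<bullet> b \<in> {0..1} \<and> \<bar>\<eta> k \<bullet> b - real (k b) / real (\<mu> b)\<bar> \<le> 1 / real (M i)"
      if k: "k \<in> Bernstein_index \<mu>" and b: "b \<in> Basis" for k b
    proof (cases "b = i")
      case False
      then have "k b \<le> m" using k b by (auto simp: Bernstein_index_def PiE_iff \<mu>_def)
      then show ?thesis using False b by (auto simp: \<eta>_inner \<mu>_def m_def)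
    next
      case True
      then have "k b \<le> n" using k b by (auto simp: Bernstein_index_def PiE_iff \<mu>_def)
      have "real (k b) / real m \<le> real (k b) / real n" "real (k b) / real n \<le> real (k b) / real m + h"
        using \<open>k b \<le> n\<close> n(2) by (auto simp: h_def m_def field_simps)
      then have "\<bar>real (k b) / real m + \<theta> k - real (k b) / real n\<bar> \<le> h"
        using \<theta>(1,2)[of k] by linarith
      moreover have "h \<le> 1 / real (M i)"
        using n(3)[OF i] M(1)[OF i] by (auto simp: h_def m_def field_simps)
      moreover have "real (k b) / real m + h \<le> 1"
        using \<open>k b \<le> n\<close> by (simp add: h_def m_def field_simps)
      ultimately show ?thesis
        using \<theta>(1,2)[of k] True b by (auto simp: \<eta>_inner \<mu>_def)
    qed
    then have "\<bar>(\<Sum>k\<in>Bernstein_index \<mu>. Bernstein_weight \<mu> k x * G (\<eta> k) i) - G x i\<bar> \<le> \<epsilon>"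
      using n(3)[OF i] by (intro Bernstein_averages_closeD[OF M(2)[OF i] _ x]) (auto simp: mem_box \<mu>_def m_def)
    then show ?thesis using D_eq by simp
  qed
  show ?thesis
    by (intro exI[of _ "Bernstein_polynomial m f"] conjI ballI allI impI
        Bernstein_polynomial_polynomial close partial)
qed

text \<open>
  An affine change of variables carries a cube around \<open>K\<close> to the unit cube and scales derivatives
  by the factor \<open>2 * R\<close>.
\<close>

lemma C1_approximation_compact:
  fixes f :: "'a::euclidean_space \<Rightarrow> real"
  assumes f: "\<And>z. (f has_derivative G z) (at z)"
    and G: "\<And>b. b \<in> Basis \<Longrightarrow> continuous_on UNIV (\<lambda>z. G z b)"
    and "compact K" and "\<epsilon> > 0"
  shows "\<exists>p. real_polynomial_function p \<and> (\<forall>x\<in>K. \<bar>p x - f x\<bar> \<le> \<epsilon> \<and>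
    (\<forall>D v. (p has_derivative D) (at x) \<longrightarrow> \<bar>D v - G x v\<bar> \<le> \<epsilon> * norm v))"
proof -
  obtain R where R: "R > 0" "\<And>x. x \<in> K \<Longrightarrow> norm x \<le> R"
    using compact_imp_bounded[OF \<open>compact K\<close>] unfolding bounded_pos by blast
  define A where "A y = (2 * R) *\<^sub>R y - R *\<^sub>R (One :: 'a)" for y
  define B where "B x = (1 / (2 * R)) *\<^sub>R (x + R *\<^sub>R (One :: 'a))" for x
  have AB: "A (B x) = x" for x using R(1) by (simp add: A_def B_def)
  have B_box: "B x \<in> cbox 0 One" if "x \<in> K" for x
  proof -
    have "0 \<le> R + x \<bullet> b \<and> R + x \<bullet> b \<le> 2 * R" if "b \<in> Basis" for b
      using Basis_le_norm[OF that, of x] R(2)[OF \<open>x \<in> K\<close>] by linarith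
    then show ?thesis using R(1) by (auto simp: B_def mem_box inner_add_left add.commute divide_le_eq)
  qed
  have A': "(A has_derivative (\<lambda>v. (2 * R) *\<^sub>R v)) (at y)" for y
    unfolding A_def by (auto intro!: derivative_eq_intros)
  have B': "(B has_derivative (\<lambda>v. (1 / (2 * R)) *\<^sub>R v)) (at x)" for x
    unfolding B_def by (auto intro!: derivative_eq_intros)
  have lin: "bounded_linear (G z)" for z using has_derivative_bounded_linear[OF f] .
  define \<epsilon>' where "\<epsilon>' = min \<epsilon> (2 * R * \<epsilon> / real DIM('a))"
  have \<epsilon>': "\<epsilon>' > 0" "\<epsilon>' \<le> \<epsilon>" "real DIM('a) * (\<epsilon>' / (2 * R)) \<le> \<epsilon>"
    using \<open>\<epsilon> > 0\<close> R(1) by (auto simp: \<epsilon>'_def min_def field_simps)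
  have fA: "((\<lambda>y. f (A y)) has_derivative (\<lambda>v. G (A y) ((2 * R) *\<^sub>R v))) (at y)" for y
    using has_derivative_compose[OF A' f] .
  have GA: "continuous_on UNIV (\<lambda>y. G (A y) ((2 * R) *\<^sub>R b))" if "b \<in> Basis" for b
  proof -
    have "continuous_on UNIV A" unfolding A_def by (intro continuous_intros)
    from continuous_on_compose2[OF G[OF that] this] have "continuous_on UNIV (\<lambda>y. G (A y) b)" by simp
    then show ?thesis
      using lin by (simp add: linear_simps continuous_on_mult_left)
  qed
  obtain q where q: "real_polynomial_function q"
    "\<And>y. y \<in> cbox 0 One \<Longrightarrow> \<bar>q y - f (A y)\<bar> \<le> \<epsilon>'"
    "\<And>y D b. y \<in> cbox 0 One \<Longrightarrow> (q has_derivative D) (at y) \<Longrightarrow> b \<in> Basis \<Longrightarrow>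
       \<bar>D b - G (A y) ((2 * R) *\<^sub>R b)\<bar> \<le> \<epsilon>'"
    using C1_approximation_unit_cube[OF fA GA \<epsilon>'(1)] by blast
  obtain E where E: "\<And>z. (q has_derivative E z) (at z)"
    using polynomial_has_derivative[OF q(1)] by blast
  have poly: "real_polynomial_function (\<lambda>x. q (B x))"
  proof -
    have "polynomial_function B"
      unfolding B_def by (intro polynomial_function_cmul polynomial_function_add) auto
    then show ?thesis using real_polynomial_function_compose[OF _ q(1)] by (simp add: o_def)
  qed
  have "\<bar>D v - G x v\<bar> \<le> \<epsilon> * norm v"
    if x: "x \<in> K" and D: "((\<lambda>x. q (B x)) has_derivative D) (at x)" for x D v
  proof -
    have "((\<lambda>x. q (B x)) has_derivative (\<lambda>v. E (B x) ((1 / (2 * R)) *\<^sub>R v))) (at x)"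
      using has_derivative_compose[OF B' E] .
    then have D_eq: "D = (\<lambda>v. E (B x) ((1 / (2 * R)) *\<^sub>R v))" by (rule has_derivative_unique[OF D])
    have linE: "bounded_linear (E (B x))" using has_derivative_bounded_linear[OF E] .
    have b: "\<bar>D b - G x b\<bar> \<le> \<epsilon>' / (2 * R)" if "b \<in> Basis" for b
    proof -
      have "\<bar>E (B x) b - 2 * R * G x b\<bar> \<le> \<epsilon>'"
        using q(3)[OF B_box[OF x] E that] lin by (simp add: AB linear_simps)
      moreover have "E (B x) b - 2 * R * G x b = 2 * R * (D b - G x b)"
        using linE R(1) by (simp add: D_eq linear_simps field_simps)
      ultimately have "2 * R * \<bar>D b - G x b\<bar> \<le> \<epsilon>'" using R(1) by (simp only: abs_mult)
      then show ?thesis using R(1) by (simp add: field_simps)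
    qed
    have diff: "bounded_linear (\<lambda>v. D v - G x v)"
      using has_derivative_bounded_linear[OF D] lin by (rule bounded_linear_sub)
    have "\<bar>D v - G x v\<bar> = \<bar>\<Sum>b\<in>Basis. (D b - G x b) * (v \<bullet> b)\<bar>"
      by (subst bounded_linear_eq_sum_Basis[OF diff]) (rule refl)
    also have "\<dots> \<le> (\<Sum>b\<in>Basis. \<bar>(D b - G x b) * (v \<bullet> b)\<bar>)" by (rule sum_abs)
    also have "\<dots> \<le> (\<Sum>b\<in>(Basis::'a set). \<epsilon>' / (2 * R) * norm v)"
      unfolding abs_mult using b \<epsilon>'(1) R(1) Basis_le_norm by (intro sum_mono mult_mono) auto
    also have "\<dots> = real DIM('a) * (\<epsilon>' / (2 * R)) * norm v" by simp
    also have "\<dots> \<le> \<epsilon> * norm v" using \<epsilon>'(3) by (intro mult_right_mono) auto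
    finally show ?thesis .
  qed
  moreover have "\<bar>q (B x) - f x\<bar> \<le> \<epsilon>" if "x \<in> K" for x
    using q(2)[OF B_box[OF that]] \<epsilon>'(2) by (simp add: AB)
  ultimately show ?thesis using poly by blast
qed

section \<open>Auxiliary functions and polynomial certificates\<close>

lemma transport_derivative_eq:
  fixes V :: "real \<times> (real ^ 'n) \<Rightarrow> real"
  assumes D: "(V has_derivative D) (at z)"
  shows "partial_t V z + w \<bullet> grad_x V z = D (1, w)"
proof -
  have fd: "frechet_derivative V (at z) = D" using frechet_derivative_at[OF D] by simp
  have lin: "bounded_linear D" using has_derivative_bounded_linear[OF D] .
  have "(\<Sum>i\<in>UNIV. w $ i *\<^sub>R (0 :: real, axis i (1::real))) = (0, w)"
  proof (rule prod_eqI)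
    have "snd (\<Sum>i\<in>UNIV. w $ i *\<^sub>R (0 :: real, axis i (1::real))) = (\<Sum>i\<in>UNIV. w $ i *\<^sub>R axis i 1)"
      by (simp add: snd_sum)
    then show "snd (\<Sum>i\<in>UNIV. w $ i *\<^sub>R (0 :: real, axis i (1::real))) = snd (0 :: real, w)"
      using basis_expansion[of w] by (simp add: scalar_mult_eq_scaleR)
  qed (simp add: fst_sum)
  then have "D (0, w) = (\<Sum>i\<in>UNIV. w $ i * D (0, axis i 1))"
    using linear_sum[OF bounded_linear.linear[OF lin], of "\<lambda>i. w $ i *\<^sub>R (0, axis i 1)" UNIV]
    by (simp only: linear_scale[OF bounded_linear.linear[OF lin]] real_scaleR_def)
  moreover have "D (1, w) = D (1, 0) + D (0, w)"
    using bounded_linear.linear[OF lin] by (metis add.left_neutral add.right_neutral add_Pair linear_add)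
  ultimately show ?thesis
    by (simp add: partial_t_def grad_x_def fd inner_vec_def)
qed

lemma polynomial_C1_function:
  fixes p :: "'a::euclidean_space \<Rightarrow> real"
  assumes "real_polynomial_function p"
  shows "C1_function p"
proof -
  obtain D where D: "\<And>z. (p has_derivative D z) (at z)" "\<And>v. real_polynomial_function (\<lambda>z. D z v)"
    using polynomial_has_derivative[OF assms] by blast
  have app: "blinfun_apply (Blinfun (D z)) = D z" for z
    using bounded_linear_Blinfun_apply[OF has_derivative_bounded_linear[OF D(1)]] .
  have "continuous_on UNIV (\<lambda>z. Blinfun (D z))"
    by (rule continuous_on_blinfun_componentwise)
       (use D(2) in \<open>simp add: app continuous_on_polymonial_function real_polynomial_function_eq\<close>)
  then show ?thesis
    unfolding C1_function_def using D(1) app by (intro exI[of _ "\<lambda>z. Blinfun (D z)"]) simp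
qed

lemma transport_derivative_polynomial:
  fixes F :: "real \<times> (real ^ 'n) \<Rightarrow> real ^ 'n"
  assumes F: "polynomial_function F" and p: "real_polynomial_function p"
  shows "real_polynomial_function (\<lambda>z. - partial_t p z - F z \<bullet> grad_x p z)"
proof -
  obtain D where D: "\<And>z. (p has_derivative D z) (at z)" "\<And>v. real_polynomial_function (\<lambda>z. D z v)"
    using polynomial_has_derivative[OF p] by blast
  have fd: "frechet_derivative p (at z) = D z" for z using frechet_derivative_at[OF D(1)] by simp
  have "real_polynomial_function (\<lambda>z. F z $ i)" for i
    using F bounded_linear_vec_nth[of i] unfolding polynomial_function_def o_def by blast
  then show ?thesis
    unfolding partial_t_def grad_x_def fd inner_vec_def
    using D(2) by (auto intro!: real_polynomial_function_diff real_polynomial_function_minus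
        real_polynomial_function_sum real_polynomial_function.intros(4))
qed

lemma polynomial_slice:
  fixes p :: "'a::real_normed_vector \<times> 'b::real_normed_vector \<Rightarrow> real"
  assumes "real_polynomial_function p"
  shows "real_polynomial_function (\<lambda>x. p (t, x))"
proof -
  have "polynomial_function (\<lambda>x :: 'b. (t, x))"
    unfolding polynomial_function_def o_def
  proof (intro allI impI)
    fix f :: "'a \<times> 'b \<Rightarrow> real" assume f: "bounded_linear f"
    have split: "(\<lambda>x. f (t, x)) = (\<lambda>x. f (t, 0) + f (0, x))"
      using linear_add[OF bounded_linear.linear[OF f], of "(t, 0)"] by (intro ext) (metis add.left_neutral add.right_neutral add_Pair)
    have "bounded_linear (\<lambda>x. f (0, x))"
      by (intro bounded_linear_compose[OF f] bounded_linear_Pair bounded_linear_zero bounded_linear_ident)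
    then show "real_polynomial_function (\<lambda>x. f (t, x))"
      unfolding split by (rule real_polynomial_function.intros(3)[OF real_polynomial_function.intros(2,1)])
  qed
  from real_polynomial_function_compose[OF this assms] show ?thesis by (simp add: o_def)
qed

text \<open>
  The certificates prove nonnegativity on the sets concerned, at every degree; so a feasible
  polynomial is an auxiliary function.
\<close>

lemma sos_bound_feasible_sound:
  assumes V: "V \<in> poly_space d"
    and dec: "(\<lambda>z. - partial_t V z - F z \<bullet> grad_x V z) \<in> weighted_sos hs ls \<mu>"
    and dom: "(\<lambda>z. V z - \<Phi> z) \<in> weighted_sos hs ls \<nu>"
    and L: "(\<lambda>x. L - V (t\<^sub>0, x)) \<in> weighted_sos fs gs \<kappa>"
  shows "V \<in> auxiliary_functions F \<Phi> (semialgebraic_set hs ls)"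
    and "(SUP x\<in>semialgebraic_set fs gs. ereal (V (t\<^sub>0, x))) \<le> ereal L"
proof -
  note nonneg = weighted_module_nonneg[OF subsetD[OF weighted_sos_subset_module]]
  show "V \<in> auxiliary_functions F \<Phi> (semialgebraic_set hs ls)"
    unfolding auxiliary_functions_def
    using polynomial_C1_function[OF poly_space_polynomial[OF V]] nonneg[OF dec] nonneg[OF dom] by force
  show "(SUP x\<in>semialgebraic_set fs gs. ereal (V (t\<^sub>0, x))) \<le> ereal L"
    using nonneg[OF L] by (intro SUP_least) force
qed

text \<open>
  Adding $\kappa(1 + T - t)$ to \<open>V\<close> lowers the derivative along the flow by \<open>\<kappa>\<close> and raises
  the values on \<open>\<Omega>\<close> by at least \<open>\<kappa>\<close>, because $t \le T$ there. At $t_0$ it costs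
  $\kappa(1 + T - t_0)$, which is chosen to be half of the slack \<open>L - c\<close>. The strict inequalities survive a
  small perturbation in $C^1$ on a compact set, so a polynomial can take the place of \<open>V\<close>.
\<close>

lemma strict_polynomial_certificate:
  fixes F :: "real \<times> (real ^ 'n) \<Rightarrow> real ^ 'n"
  assumes F: "continuous_on \<Omega> F" and \<Omega>: "compact \<Omega>" "\<Omega> \<subseteq> {t\<^sub>0..T} \<times> UNIV" and "compact X\<^sub>0"
    and "t\<^sub>0 \<le> T" and V: "V \<in> auxiliary_functions F \<Phi> \<Omega>"
    and c: "\<And>x. x \<in> X\<^sub>0 \<Longrightarrow> V (t\<^sub>0, x) \<le> c" and "c < L"
  shows "\<exists>P. real_polynomial_function P \<and>
    (\<forall>z\<in>\<Omega>. - partial_t P z - F z \<bullet> grad_x P z > 0 \<and> P z - \<Phi> z > 0) \<and> (\<forall>x\<in>X\<^sub>0. L - P (t\<^sub>0, x) > 0)"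
proof -
  obtain V' where V': "\<And>z. (V has_derivative blinfun_apply (V' z)) (at z)" "continuous_on UNIV V'"
    using V unfolding auxiliary_functions_def C1_function_def by blast
  define \<kappa> where "\<kappa> = (L - c) / (2 * (1 + T - t\<^sub>0))"
  have \<kappa>: "\<kappa> > 0" "\<kappa> * (1 + T - t\<^sub>0) = (L - c) / 2"
    using \<open>c < L\<close> \<open>t\<^sub>0 \<le> T\<close> by (auto simp: \<kappa>_def field_simps)
  have "\<kappa> * 1 \<le> \<kappa> * (1 + T - t\<^sub>0)" using \<kappa>(1) \<open>t\<^sub>0 \<le> T\<close> by (intro mult_left_mono) auto
  then have \<kappa>_le: "\<kappa> \<le> (L - c) / 2" using \<kappa>(2) by simp
  define W where "W z = V z + \<kappa> * (1 + T - fst z)" for z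
  define G where "G z v = blinfun_apply (V' z) v - \<kappa> * fst v" for z v
  have W: "(W has_derivative G z) (at z)" for z
    unfolding W_def[abs_def] G_def[abs_def]
    by (auto intro!: derivative_eq_intros V'(1))
  have G: "continuous_on UNIV (\<lambda>z. G z v)" for v
    unfolding G_def by (intro continuous_intros V'(2))
  have "continuous_on \<Omega> (\<lambda>z. (1 :: real, F z))" by (intro continuous_intros F)
  then have "bounded ((\<lambda>z. (1 :: real, F z)) ` \<Omega>)"
    using \<Omega>(1) compact_continuous_image compact_imp_bounded by blast
  then obtain B where B: "B > 0" "\<And>z. z \<in> \<Omega> \<Longrightarrow> norm (1 :: real, F z) \<le> B"
    unfolding bounded_pos by blast
  define \<epsilon> where "\<epsilon> = \<kappa> / (2 * (B + 1))"
  have \<epsilon>: "\<epsilon> > 0" "\<epsilon> < \<kappa>" "\<epsilon> * B < \<kappa>"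
    using \<kappa>(1) B(1) by (auto simp: \<epsilon>_def field_simps intro: add_pos_pos)
  \<comment> \<open>The approximation must be good on both sets on which inequalities are to be preserved.\<close>
  have "compact (\<Omega> \<union> {t\<^sub>0} \<times> X\<^sub>0)"
    using \<Omega>(1) \<open>compact X\<^sub>0\<close> by (intro compact_Un compact_Times) auto
  from C1_approximation_compact[OF W G this \<epsilon>(1)] obtain P where P: "real_polynomial_function P"
    and close: "\<And>z. z \<in> \<Omega> \<union> {t\<^sub>0} \<times> X\<^sub>0 \<Longrightarrow> \<bar>P z - W z\<bar> \<le> \<epsilon>"
    and close': "\<And>z D v. z \<in> \<Omega> \<union> {t\<^sub>0} \<times> X\<^sub>0 \<Longrightarrow> (P has_derivative D) (at z) \<Longrightarrow> \<bar>D v - G z v\<bar> \<le> \<epsilon> * norm v"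
    by blast
  obtain D where D: "\<And>z. (P has_derivative D z) (at z)"
    using polynomial_has_derivative[OF P] by blast
  have "- partial_t P z - F z \<bullet> grad_x P z > 0 \<and> P z - \<Phi> z > 0" if z: "z \<in> \<Omega>" for z
  proof
    have "partial_t V z + F z \<bullet> grad_x V z \<le> 0" and dom: "\<Phi> z - V z \<le> 0"
      using V z unfolding auxiliary_functions_def by blast+
    then have "G z (1, F z) \<le> - \<kappa>"
      unfolding transport_derivative_eq[OF V'(1)] by (simp add: G_def)
    moreover have "\<epsilon> * norm (1 :: real, F z) \<le> \<epsilon> * B"
      using B(2)[OF z] \<epsilon>(1) by (intro mult_left_mono) auto
    then have "\<bar>D z (1, F z) - G z (1, F z)\<bar> \<le> \<epsilon> * B"
      using close'[OF _ D, of z "(1, F z)"] z by force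
    moreover have "partial_t P z + F z \<bullet> grad_x P z = D z (1, F z)"
      by (rule transport_derivative_eq[OF D])
    ultimately show "- partial_t P z - F z \<bullet> grad_x P z > 0" using \<epsilon>(3) by linarith
    have "fst z \<le> T" using z \<Omega>(2) by auto
    then have "\<kappa> * 1 \<le> \<kappa> * (1 + T - fst z)" using \<kappa>(1) by (intro mult_left_mono) auto
    then have "W z \<ge> \<Phi> z + \<kappa>" using dom by (simp add: W_def)
    then show "P z - \<Phi> z > 0" using close[of z] z \<epsilon>(2) by auto
  qed
  moreover have "L - P (t\<^sub>0, x) > 0" if "x \<in> X\<^sub>0" for x
  proof -
    have "W (t\<^sub>0, x) = V (t\<^sub>0, x) + \<kappa> * (1 + T - t\<^sub>0)" by (simp add: W_def)
    then have "W (t\<^sub>0, x) \<le> c + (L - c) / 2" using c[OF that] \<kappa>(2) by linarith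
    then show ?thesis using close[of "(t\<^sub>0, x)"] that \<epsilon>(2) \<kappa>_le by (auto simp: field_simps)
  qed
  ultimately show ?thesis using P by blast
qed

theorem theorem4p1:
  fixes F :: "real \<times> (real ^ 'n) \<Rightarrow> real ^ 'n"
    and \<Phi> :: "real \<times> (real ^ 'n) \<Rightarrow> real"
    and t\<^sub>0 T C\<^sub>1 C\<^sub>2 :: real
    and fs gs :: "(real ^ 'n \<Rightarrow> real) list"
    and hs ls :: "(real \<times> (real ^ 'n) \<Rightarrow> real) list"
    and X\<^sub>0 :: "(real ^ 'n) set"
    and \<Omega> :: "(real \<times> (real ^ 'n)) set"
    and x :: "real ^ 'n \<Rightarrow> real \<Rightarrow> real ^ 'n"
  assumes "polynomial_function F"
    and "real_polynomial_function \<Phi>"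
    and "t\<^sub>0 \<le> T"
    and "\<forall>f \<in> set fs \<union> set gs. real_polynomial_function f"
    and "\<forall>h \<in> set hs \<union> set ls. real_polynomial_function h"
    and "X\<^sub>0 = semialgebraic_set fs gs"
    and "\<Omega> = semialgebraic_set hs ls"
    and "compact X\<^sub>0"
    and "compact \<Omega>"
    and "\<Omega> \<subseteq> {t\<^sub>0..T} \<times> UNIV"
    and "\<forall>x\<^sub>0 \<in> X\<^sub>0. is_trajectory F t\<^sub>0 T x\<^sub>0 (x x\<^sub>0)"
    and "\<forall>x\<^sub>0 \<in> X\<^sub>0. (\<lambda>t. (t, x x\<^sub>0 t)) ` {t\<^sub>0..T} \<subseteq> \<Omega>"
    and "(\<lambda>(t, y). C\<^sub>1 - t\<^sup>2 - (norm y)\<^sup>2) \<in> set hs"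
    and "(\<lambda>y. C\<^sub>2 - (norm y)\<^sup>2) \<in> set fs"
    and "max_along_trajectories \<Phi> t\<^sub>0 T X\<^sub>0 x =
           (INF V \<in> auxiliary_functions F \<Phi> \<Omega>. SUP x\<^sub>0 \<in> X\<^sub>0. ereal (V (t\<^sub>0, x\<^sub>0)))"
  shows "(\<lambda>d. sos_bound F \<Phi> t\<^sub>0 fs gs hs ls d) \<longlonglongrightarrow> max_along_trajectories \<Phi> t\<^sub>0 T X\<^sub>0 x"
proof -
  note F_poly = assms(1) and Phi_poly = assms(2) and t0_le = assms(3) and fs_poly = assms(4) and hs_poly = assms(5) and X0_def = assms(6)
    and Omega_def = assms(7) and X0_compact = assms(8) and Omega_compact = assms(9) and Omega_strip = assms(10) and ball_X0 = assms(14) and sharp = assms(15)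
  have "(\<lambda>(t, y :: real ^ 'n). C\<^sub>1 - t\<^sup>2 - (norm y)\<^sup>2) = (\<lambda>z. C\<^sub>1 - (norm z)\<^sup>2)"
    by (auto simp: norm_Pair)
  then have ball: "(\<lambda>z. C\<^sub>1 - (norm z)\<^sup>2) \<in> set hs" using assms(13) by simp
  define l where "l = max_along_trajectories \<Phi> t\<^sub>0 T X\<^sub>0 x"
  note l_eq = sharp[folded l_def]
  \<comment> \<open>A feasible polynomial competes in the infimum over auxiliary functions.\<close>
  have lower: "l \<le> sos_bound F \<Phi> t\<^sub>0 fs gs hs ls d" for d
    unfolding sos_bound_def
  proof (rule Inf_greatest, clarify)
    fix L V
    assume *: "V \<in> poly_space d"
      "(\<lambda>z. - partial_t V z - F z \<bullet> grad_x V z) \<in> weighted_sos hs ls (d - 1 + vec_poly_degree F)"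
      "(\<lambda>z. V z - \<Phi> z) \<in> weighted_sos hs ls d" "(\<lambda>x. L - V (t\<^sub>0, x)) \<in> weighted_sos fs gs d"
    note sound = sos_bound_feasible_sound[OF *, folded X0_def Omega_def]
    have "l \<le> (SUP x\<^sub>0 \<in> X\<^sub>0. ereal (V (t\<^sub>0, x\<^sub>0)))"
      unfolding l_eq by (rule INF_lower[OF sound(1)])
    then show "l \<le> ereal L" using sound(2) by (rule order_trans)
  qed
  have upper: "\<forall>\<^sub>F d in sequentially. sos_bound F \<Phi> t\<^sub>0 fs gs hs ls d < a" if a: "l < a" for a
  proof -
    obtain V where V: "V \<in> auxiliary_functions F \<Phi> \<Omega>" "(SUP x\<^sub>0 \<in> X\<^sub>0. ereal (V (t\<^sub>0, x\<^sub>0))) < a"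
      using a unfolding l_eq INF_less_iff by blast
    obtain c where c: "(SUP x\<^sub>0 \<in> X\<^sub>0. ereal (V (t\<^sub>0, x\<^sub>0))) < ereal c" "ereal c < a"
      using ereal_dense2[OF V(2)] by blast
    obtain L where L: "ereal c < ereal L" "ereal L < a"
      using ereal_dense2[OF c(2)] by blast
    have "V (t\<^sub>0, y) \<le> c" if "y \<in> X\<^sub>0" for y
      using SUP_upper[OF that, of "\<lambda>y. ereal (V (t\<^sub>0, y))"] c(1)
      by (metis ereal_less_eq(3) less_imp_le order_trans)
    moreover have "continuous_on \<Omega> F" using F_poly by (rule continuous_on_polymonial_function)
    ultimately obtain P where P: "real_polynomial_function P"
      and P_\<Omega>: "\<And>z. z \<in> \<Omega> \<Longrightarrow> - partial_t P z - F z \<bullet> grad_x P z > 0"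
        "\<And>z. z \<in> \<Omega> \<Longrightarrow> P z - \<Phi> z > 0"
      and P_X: "\<And>y. y \<in> X\<^sub>0 \<Longrightarrow> L - P (t\<^sub>0, y) > 0"
      using strict_polynomial_certificate[OF _ Omega_compact Omega_strip X0_compact t0_le V(1), of c L] L(1) by auto
    have "\<forall>\<^sub>F \<mu> in sequentially. (\<lambda>z. - partial_t P z - F z \<bullet> grad_x P z) \<in> weighted_sos hs ls \<mu>"
      by (rule putinar_positivstellensatz[OF hs_poly ball transport_derivative_polynomial[OF F_poly P]])
         (use P_\<Omega>(1) Omega_def in blast)
    then obtain N where N: "\<And>\<mu>. \<mu> \<ge> N \<Longrightarrow>
        (\<lambda>z. - partial_t P z - F z \<bullet> grad_x P z) \<in> weighted_sos hs ls \<mu>"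
      unfolding eventually_sequentially by blast
    have "\<forall>\<^sub>F d in sequentially. d \<ge> Suc N" by (rule eventually_ge_at_top)
    moreover have "\<forall>\<^sub>F d in sequentially. (\<lambda>z. P z - \<Phi> z) \<in> weighted_sos hs ls d"
      by (rule putinar_positivstellensatz[OF hs_poly ball real_polynomial_function_diff[OF P Phi_poly]])
         (use P_\<Omega>(2) Omega_def in blast)
    moreover have "\<forall>\<^sub>F d in sequentially. (\<lambda>y. L - P (t\<^sub>0, y)) \<in> weighted_sos fs gs d"
      by (rule putinar_positivstellensatz[OF fs_poly ball_X0 real_polynomial_function_diff[OF
            real_polynomial_function.intros(2) polynomial_slice[OF P]]])
         (use P_X X0_def in blast)
    moreover have "\<forall>\<^sub>F d in sequentially. P \<in> poly_space d"
      using eventually_in_poly_space[OF P, of 0] by simp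
    ultimately show ?thesis
    proof eventually_elim
      case (elim d)
      then have "N \<le> d - 1 + vec_poly_degree F" by simp
      then have "sos_bound F \<Phi> t\<^sub>0 fs gs hs ls d \<le> ereal L"
        unfolding sos_bound_def using elim N by (intro Inf_lower) blast
      then show ?case using L(2) by (rule order.strict_trans1)
    qed
  qed
  show ?thesis
    unfolding l_def[symmetric]
  proof (rule order_tendstoI)
    show "\<forall>\<^sub>F d in sequentially. a < sos_bound F \<Phi> t\<^sub>0 fs gs hs ls d" if "a < l" for a
      using order.strict_trans2[OF that lower] by simp
  qed (rule upper)
qed

end
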